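(* Let $A\in\mathbb{R}_+^{n\times n}$ with $\lambda(A)\neq 0$, and let $\mathcal{C}_1,\dots,\mathcal{C}_{n_c}$ be the strongly connected components of the critical graph $\mathcal{C}(A)$, with cyclicities $\gamma_1,\dots,\gamma_{n_c}$. Then for every integer $k\ge 1$: (1) $\lambda(A^k)=\lambda(A)^k$. (2) $(A^{[C]})^k=(A^k)^{[C]}$. (3) There exists a permutation matrix $P$ such that, for each $\mu=1,\dots,n_c$, the matrix $(P^{-1}A^kP)^{[C]}_{\mu\mu}$ has $r_\mu:=\gcd(k,\gamma_\mu)$ irreducible (diagonal) blocks and all elements outside these blocks are zero. The cyclicity of all these blocks in $(P^{-1}A^kP)^{[C]}_{\mu\mu}$ is equal to $\gamma_\mu/r_\mu$.
   Context: Max algebra: on $\mathbb{R}_+=[0,\infty)$ put $a\oplus b=\max(a,b)$, $a\otimes b=ab$, extended to matrices by $(A\otimes B)_{ij}=\max_k a_{ik}b_{kj}$; $A^k$ is the $k$-th max-algebraic power. The digraph $\mathcal{D}(A)$ has nodes $1,\dots,n$ and an edge $(i,j)$ of weight $a_{ij}$ iff $a_{ij}\neq 0$; the weight of a path is the product of its edge weights, and the geometric mean of a cycle with $k$ edges is its weight to the power $1/k$. $\lambda(A)$ is the maximum cycle geometric mean ($0$ if there are no cycles). A cycle is critical if its geometric mean equals $\lambda(A)$; the critical graph $\mathcal{C}(A)=(N_c(A),E_c(A))$ consists of all nodes and edges belonging to critical cycles. Its strongly connected components $\mathcal{C}_\mu$ are pairwise disjoint, with node sets $N_\mu$. The cyclicity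 of a strongly connected digraph is the gcd of the lengths of its cycles. A $0$-$1$ (Boolean) matrix is irreducible if its digraph is strongly connected, and its cyclicity is that of its digraph. $A^{[C]}$ is the $0$-$1$ matrix whose $(i,j)$ entry is $1$ if $(i,j)\in E_c(A)$ and $0$ otherwise; its powers are Boolean (equivalently max-algebraic) powers. For a matrix $B$, $B_{\mu\nu}$ is the block of $B$ with rows in $N_\mu$ and columns in $N_\nu$. *)

theory Defs
  imports
    "Jordan_Normal_Form.DL_Submatrix"
    "Graph_Theory.Graph_Theory"
    "HOL-Combinatorics.Permutations"
begin

text \<open>
  Square matrices over the max-times semiring of nonnegative reals are represented as
  \<^typ>\<open>real mat\<close> with nonnegative entries; rows, columns and nodes are numbered from \<open>0\<close> to \<open>n - 1\<close>.
\<close>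

definition nonneg_mat :: "real mat \<Rightarrow> bool" where
  "nonneg_mat A \<longleftrightarrow> (\<forall>i<dim_row A. \<forall>j<dim_col A. 0 \<le> A $$ (i, j))"

text \<open>The \<open>0\<close> inserted under the maximum is the neutral element of \<open>max\<close> on the nonnegative reals;
  it matters only for an empty inner dimension.\<close>

definition max_mult_mat :: "real mat \<Rightarrow> real mat \<Rightarrow> real mat"  (infixl "\<otimes>\<^sub>m" 70) where
  "A \<otimes>\<^sub>m B = mat (dim_row A) (dim_col B)
     (\<lambda>(i, j). Max (insert 0 ((\<lambda>k. A $$ (i, k) * B $$ (k, j)) ` {0..<dim_col A})))"

primrec max_pow_mat :: "real mat \<Rightarrow> nat \<Rightarrow> real mat" where
  "max_pow_mat A 0 = 1\<^sub>m (dim_row A)"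
| "max_pow_mat A (Suc k) = max_pow_mat A k \<otimes>\<^sub>m A"

definition mat_digraph :: "real mat \<Rightarrow> nat pair_pre_digraph" where
  "mat_digraph A = \<lparr> pverts = {0..<dim_row A},
     parcs = {(i, j). i < dim_row A \<and> j < dim_col A \<and> A $$ (i, j) \<noteq> 0} \<rparr>"

text \<open>Cycles are those of \<^const>\<open>pre_digraph.cycle\<close>: nonempty arc lists of elementary cycles, loops
  included. Hence a finite digraph has finitely many of them, and the maximum in \<open>max_cycle_mean\<close>
  is one of a finite set.\<close>

abbreviation mat_cycle :: "real mat \<Rightarrow> (nat \<times> nat) list \<Rightarrow> bool" where
  "mat_cycle A p \<equiv> pre_digraph.cycle (with_proj (mat_digraph A)) p"

definition path_weight :: "real mat \<Rightarrow> (nat \<times> nat) list \<Rightarrow> real" where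
  "path_weight A p = (\<Prod>e\<leftarrow>p. A $$ e)"

definition cycle_mean :: "real mat \<Rightarrow> (nat \<times> nat) list \<Rightarrow> real" where
  "cycle_mean A p = root (length p) (path_weight A p)"

definition max_cycle_mean :: "real mat \<Rightarrow> real" where
  "max_cycle_mean A =
     (if \<exists>p. mat_cycle A p then Max (cycle_mean A ` {p. mat_cycle A p}) else 0)"

definition critical_cycle :: "real mat \<Rightarrow> (nat \<times> nat) list \<Rightarrow> bool" where
  "critical_cycle A p \<longleftrightarrow> mat_cycle A p \<and> cycle_mean A p = max_cycle_mean A"

definition critical_graph :: "real mat \<Rightarrow> nat pair_pre_digraph" where
  "critical_graph A =
     \<lparr> pverts = {v. \<exists>p. critical_cycle A p \<and> (\<exists>e\<in>set p. v = fst e \<or> v = snd e)},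
       parcs = {e. \<exists>p. critical_cycle A p \<and> e \<in> set p} \<rparr>"

definition critical_components :: "real mat \<Rightarrow> (nat, nat \<times> nat) pre_digraph set" where
  "critical_components A = pre_digraph.sccs (with_proj (critical_graph A))"

definition crit_mat :: "real mat \<Rightarrow> real mat" where
  "crit_mat A = mat (dim_row A) (dim_col A)
     (\<lambda>(i, j). if (i, j) \<in> parcs (critical_graph A) then 1 else 0)"

definition cyclicity :: "('a, 'b) pre_digraph \<Rightarrow> nat" where
  "cyclicity G = Gcd {length p | p. pre_digraph.cycle G p}"

definition irreducible_mat :: "real mat \<Rightarrow> bool" where
  "irreducible_mat B \<longleftrightarrow> square_mat B \<and> strongly_connected (with_proj (mat_digraph B))"

definition mat_cyclicity :: "real mat \<Rightarrow> nat" where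
  "mat_cyclicity B = cyclicity (with_proj (mat_digraph B))"

text \<open>Column \<open>j\<close> is the unit vector \<open>e\<^bsub>\<sigma> j\<^esub>\<close>, so that conjugation gives
  \<open>(P\<^sup>-\<^sup>1 B P)\<^bsub>ij\<^esub> = B\<^bsub>\<sigma> i, \<sigma> j\<^esub>\<close>.\<close>

definition permutation_mat :: "nat \<Rightarrow> (nat \<Rightarrow> nat) \<Rightarrow> real mat" where
  "permutation_mat n \<sigma> = mat n n (\<lambda>(i, j). if i = \<sigma> j then 1 else 0)"

text \<open>Nonnegativity is needed for uniqueness of the inverse, since \<open>max_mult_mat\<close> is meant for
  nonnegative entries only.\<close>

definition max_inverse_mat :: "real mat \<Rightarrow> real mat \<Rightarrow> bool" where
  "max_inverse_mat P Q \<longleftrightarrow>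
     nonneg_mat Q \<and> P \<otimes>\<^sub>m Q = 1\<^sub>m (dim_row P) \<and> Q \<otimes>\<^sub>m P = 1\<^sub>m (dim_row Q)"

end

theory Submission
  imports Defs "HOL-Number_Theory.Cong"
begin

text \<open>
  Let $\lambda = \lambda(A)$. Taking maximal weights of paths in $\lambda^{-1} A$ yields a positive
  vector $x$ with $a_{ij} x_j \le \lambda x_i$. The edges of the critical graph are then exactly
  the edges of the saturation graph $\{(i, j) : a_{ij} x_j = \lambda x_i\}$ that lie on closed
  walks in it. The same $x$ serves $A^k$ with $\lambda^k$, and the saturation graph of $A^k$ is the
  $k$-th relational power of that of $A$; this gives (1) and, since taking the edges on closed
  walks commutes with relational powers, (2).

  For (3), walk lengths from a fixed node of a component define a class modulo
  $r = \gcd(k, \gamma)$ for each node, and two nodes have the same class iff they are connected by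
  a walk whose length is divisible by $k$. Sorting each component by this class makes the matrix
  block diagonal.
\<close>

subsection \<open>Powers and periods of relations\<close>

text \<open>The obstacle is that \<open>max_cycle_mean\<close> and \<open>critical_graph\<close>
  refer to elementary cycles, while a cycle of the power stands for a closed walk of
  \<open>A\<close> that may repeat nodes, and a cycle of \<open>A\<close> yields in general only a
  closed walk of the power. The vector x avoids comparing cycles: along a closed walk its entries
  cancel, so criticality becomes an equality at each single edge, and such equalities pass to
  products. Powers commute with taking edges on closed walks because a return walk can be prolonged
  by going around a closed walk until its length is a multiple of k. The number gcd(k, gamma) arises
  because the lengths of closed walks at a node, reduced modulo k, fill the subgroup of Z/k
  generated by gamma; working with residues keeps any threshold on walk lengths out of the
  argument.\<close>

lemma relpow_mult: "(R ^^ k) ^^ m = (R :: 'a rel) ^^ (k * m)"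
  by (induction m) (simp_all add: relpow_add[symmetric] add.commute)

lemma rtrancl_relpow_iff: "(i, j) \<in> (R ^^ k)\<^sup>* \<longleftrightarrow> (\<exists>m. (i, j) \<in> R ^^ (k * m))"
  by (simp add: rtrancl_is_UN_relpow relpow_mult)

lemma relpow_closed_mult: "(i, i) \<in> R ^^ a \<Longrightarrow> (i, i) \<in> R ^^ (a * b)"
  by (induction b) (auto intro: relpow_trans simp: add.commute)

text \<open>These are the edges with both ends in the same strongly connected component of
  \<open>R\<close>, loops included.\<close>

definition cyclic_part :: "'a rel \<Rightarrow> 'a rel" where
  "cyclic_part R = {(i, j) \<in> R. (j, i) \<in> R\<^sup>*}"

lemma cyclic_part_subset: "cyclic_part R \<subseteq> R"
  by (auto simp: cyclic_part_def)

text \<open>The way back from \<open>j\<close> to \<open>i\<close> closes the walk, so each of its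
  edges lies on a closed walk.\<close>

lemma relpow_imp_cyclic_part_relpow:
  assumes "(i, j) \<in> R ^^ k" "(j, i) \<in> R\<^sup>*"
  shows "(i, j) \<in> cyclic_part R ^^ k"
  using assms
proof (induction k arbitrary: j)
  case (Suc k)
  then obtain l where l: "(i, l) \<in> R ^^ k" "(l, j) \<in> R"
    by auto
  from l Suc.prems have "(l, i) \<in> R\<^sup>*" by (meson converse_rtrancl_into_rtrancl)
  moreover from l Suc.prems have "(j, l) \<in> R\<^sup>*" by (meson relpow_imp_rtrancl rtrancl_trans)
  ultimately show ?case using Suc.IH l by (auto simp: cyclic_part_def)
qed auto

text \<open>An edge of the cyclic part closes its own return walk, so by the preceding lemma that
  return walk stays in the cyclic part; a walk is then reversed edge by edge.\<close>

lemma relpow_cyclic_partD: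
  assumes "(i, j) \<in> cyclic_part R ^^ k"
  shows "(i, j) \<in> R ^^ k" "(j, i) \<in> (cyclic_part R)\<^sup>*"
proof -
  show "(i, j) \<in> R ^^ k"
    using assms
  proof (induction k arbitrary: j)
    case (Suc k)
    then show ?case using cyclic_part_subset by auto
  qed simp
  have edge: "(v, u) \<in> (cyclic_part R)\<^sup>*" if "(u, v) \<in> cyclic_part R" for u v
  proof -
    from that have uv: "(u, v) \<in> R" and "(v, u) \<in> R\<^sup>*" by (auto simp: cyclic_part_def)
    then obtain m where "(v, u) \<in> R ^^ m" by (auto simp: rtrancl_is_UN_relpow)
    with uv have "(v, u) \<in> cyclic_part R ^^ m"
      by (intro relpow_imp_cyclic_part_relpow) auto
    then show ?thesis by (rule relpow_imp_rtrancl)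
  qed
  show "(j, i) \<in> (cyclic_part R)\<^sup>*"
    using assms
  proof (induction k arbitrary: j)
    case (Suc k)
    then show ?case using edge by (auto intro: rtrancl_trans)
  qed simp
qed

lemma cyclic_part_rtrancl_sym:
  assumes "(i, j) \<in> (cyclic_part R)\<^sup>*"
  shows "(j, i) \<in> (cyclic_part R)\<^sup>*"
  using assms relpow_cyclic_partD(2) by (metis rtrancl_imp_relpow)

lemma cyclic_part_relpow:
  assumes "k > 0"
  shows "cyclic_part (R ^^ k) = cyclic_part R ^^ k"
proof (intro equalityI subsetI; clarify)
  fix i j
  assume "(i, j) \<in> cyclic_part (R ^^ k)"
  then have "(i, j) \<in> R ^^ k" "(j, i) \<in> R\<^sup>*"
    by (auto simp: cyclic_part_def rtrancl_relpow_iff intro: relpow_imp_rtrancl)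
  then show "(i, j) \<in> cyclic_part R ^^ k" by (rule relpow_imp_cyclic_part_relpow)
next
  fix i j
  assume ij: "(i, j) \<in> cyclic_part R ^^ k"
  from relpow_cyclic_partD[OF ij] have k: "(i, j) \<in> R ^^ k" and "(j, i) \<in> R\<^sup>*"
    using rtrancl_mono[OF cyclic_part_subset] by auto
  then obtain m where m: "(j, i) \<in> R ^^ m" by (auto simp: rtrancl_is_UN_relpow)
  \<comment> \<open>Go back to \<open>i\<close> in \<open>m\<close> steps and then
    \<open>k - 1\<close> times around the closed walk of length \<open>k + m\<close> at
    \<open>i\<close>. The total length is a multiple of \<open>k\<close>, hence a walk in
    \<open>R ^^ k\<close>.\<close>
  from assms have "m + (k + m) * (k - 1) = k * (m + k - 1)"
    by (cases k) (auto simp: algebra_simps)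
  moreover have "(j, i) \<in> R ^^ (m + (k + m) * (k - 1))"
    using relpow_trans[OF m relpow_closed_mult[OF relpow_trans[OF k m]]] .
  ultimately have "(j, i) \<in> (R ^^ k)\<^sup>*" by (metis rtrancl_relpow_iff)
  with k show "(i, j) \<in> cyclic_part (R ^^ k)" by (simp add: cyclic_part_def)
qed

text \<open>A node known only as the end of an edge gets its outgoing edge from the return walk,
  which is empty only if the edge is a loop.\<close>

lemma cyclic_part_successor:
  assumes "i \<in> Field (cyclic_part R)"
  shows "\<exists>j. (i, j) \<in> cyclic_part R"
proof (cases "i \<in> Domain (cyclic_part R)")
  case False
  then obtain u where u: "(u, i) \<in> cyclic_part R" using assms by (auto simp: Field_def)
  then have "(i, u) \<in> (cyclic_part R)\<^sup>*" by (rule cyclic_part_rtrancl_sym[OF r_into_rtrancl])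
  then show ?thesis
  proof (cases rule: converse_rtranclE)
    case base
    with u show ?thesis by blast
  qed blast
qed auto

lemma relpow_successor:
  assumes "\<And>i. i \<in> Field R \<Longrightarrow> \<exists>j. (i, j) \<in> R" "i \<in> Field R"
  shows "\<exists>j. (i, j) \<in> R ^^ k"
proof (induction k)
  case (Suc k)
  then obtain j where j: "(i, j) \<in> R ^^ k" by auto
  then have "j \<in> Field R" using assms(2) by (cases k) (auto simp: Field_def)
  then obtain l where "(j, l) \<in> R" using assms(1) by blast
  with j show ?case by auto
qed auto

text \<open>Modulo \<open>k\<close> the set \<open>S\<close> is a submonoid of a finite cyclic
  group, hence a subgroup, and its generator divides both \<open>k\<close> and all of
  \<open>S\<close>.\<close>

lemma add_closed_cong:
  fixes S :: "nat set"
  assumes "0 \<in> S" and add: "\<And>a b. a \<in> S \<Longrightarrow> b \<in> S \<Longrightarrow> a + b \<in> S"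
    and "k > 0" and "gcd k (Gcd S) dvd d"
  obtains s where "s \<in> S" "[s = d] (mod k)"
proof -
  \<comment> \<open>\<open>H\<close> is the union of the residue classes that meet \<open>S\<close>;
    being invariant under congruence, it also allows subtraction.\<close>
  define H where "H = {h :: nat. \<exists>s\<in>S. [s = h] (mod k)}"
  have H0: "k \<in> H" "0 \<in> H"
    using \<open>0 \<in> S\<close> by (auto simp: H_def cong_def intro: bexI[of _ 0])
  have H_add: "a + b \<in> H" if "a \<in> H" "b \<in> H" for a b
    using that add unfolding H_def by (blast intro: cong_add)
  have H_mult: "a * b \<in> H" if "a \<in> H" for a b
  proof (induction b)
    case 0 show ?case using H0 by simp
  qed (use that H_add in auto)
  have H_cong: "b \<in> H" if "a \<in> H" "[a = b] (mod k)" for a b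
    using that unfolding H_def by (blast intro: cong_trans)
  \<comment> \<open>This is the generator of the subgroup. It exists because
    \<open>0 \<in> S\<close> puts \<open>k\<close> into \<open>H\<close>.\<close>
  define h where "h = (LEAST h. h \<in> H \<and> h > 0)"
  have h: "h \<in> H" "h > 0"
    using LeastI[of "\<lambda>h. h \<in> H \<and> h > 0" k] H0 \<open>k > 0\<close> by (auto simp: h_def)
  have h_dvd: "h dvd a" if "a \<in> H" for a
  proof -
    \<comment> \<open>Modulo \<open>k\<close>, adding \<open>k - 1\<close> copies amounts to subtracting, so \<open>H\<close> acts as a subgroup.\<close>
    have "a + h * (a div h) * (k - 1) \<in> H"
      using that h H_mult H_add by (simp add: mult.assoc)
    moreover have "[a + h * (a div h) * (k - 1) = a mod h] (mod k)"
    proof -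
      have "a + h * (a div h) * (k - 1) = a mod h + k * (h * (a div h))"
        using \<open>k > 0\<close> by (cases k) (auto simp: algebra_simps)
      then show ?thesis by (simp add: cong_def)
    qed
    ultimately have "a mod h \<in> H" by (rule H_cong)
    then have "a mod h = 0"
      using not_less_Least[of "a mod h" "\<lambda>h. h \<in> H \<and> h > 0"] h by (auto simp flip: h_def)
    then show ?thesis by auto
  qed
  have "S \<subseteq> H" unfolding H_def by (blast intro: cong_refl)
  then have "h dvd gcd k (Gcd S)" using h_dvd H0 by (auto intro: Gcd_greatest)
  with \<open>gcd k (Gcd S) dvd d\<close> have "h dvd d" by (rule_tac dvd_trans)
  then obtain b where "d = h * b" by blast
  with h H_mult have "d \<in> H" by simp
  then show thesis using that by (auto simp: H_def)
qed

text \<open>All closed walks through \<open>i\<close> count here, not only elementary cycles, so the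
  set of lengths is closed under addition and its version for \<open>R ^^ k\<close> consists of the
  \<open>m\<close> with \<open>k * m\<close> in the version for \<open>R\<close>. The value is 0 if
  only the empty walk returns to \<open>i\<close>.\<close>

definition period :: "'a rel \<Rightarrow> 'a \<Rightarrow> nat" where
  "period R i = Gcd {m. (i, i) \<in> R ^^ m}"

lemma period_dvd: "(i, i) \<in> R ^^ m \<Longrightarrow> period R i dvd m"
  by (simp add: period_def Gcd_dvd)

text \<open>One and the same return walk closes both walks.\<close>

lemma period_cong_relpow:
  assumes "(i, j) \<in> R ^^ a" "(i, j) \<in> R ^^ b" "(j, i) \<in> R\<^sup>*"
  shows "[a = b] (mod period R i)"
proof -
  obtain c where c: "(j, i) \<in> R ^^ c" using assms(3) by (auto simp: rtrancl_is_UN_relpow)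
  have "period R i dvd a + c" "period R i dvd b + c"
    using assms c by (auto intro: period_dvd relpow_trans)
  then have "[a + c = b + c] (mod period R i)" by (metis cong_0_iff cong_sym cong_trans)
  then show ?thesis by (simp add: cong_add_rcancel_nat)
qed

text \<open>A closed walk at \<open>j\<close> can be inserted into a closed walk from
  \<open>i\<close> through \<open>j\<close>; the difference of the two lengths is the inserted
  length.\<close>

lemma period_eq:
  assumes "(i, j) \<in> R\<^sup>*" "(j, i) \<in> R\<^sup>*"
  shows "period R i = period R j"
proof -
  have *: "period R i dvd period R j" if ij: "(i, j) \<in> R\<^sup>*" "(j, i) \<in> R\<^sup>*" for i j
  proof -
    obtain a b where ab: "(i, j) \<in> R ^^ a" "(j, i) \<in> R ^^ b"
      using ij by (meson rtrancl_imp_relpow)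
    have "period R i dvd m" if m: "(j, j) \<in> R ^^ m" for m
    proof -
      have "period R i dvd a + b" "period R i dvd a + m + b"
        using ab m by (auto intro: period_dvd relpow_trans)
      then show ?thesis by (metis add.assoc add.commute dvd_add_right_iff)
    qed
    then show ?thesis by (subst (2) period_def) (auto intro: Gcd_greatest)
  qed
  show ?thesis using *[OF assms] *[OF assms(2,1)] by (rule dvd_antisym)
qed

lemma period_add_closed:
  assumes "k > 0" "gcd k (period R i) dvd d"
  obtains s where "(i, i) \<in> R ^^ s" "[s = d] (mod k)"
  using add_closed_cong[of "{m. (i, i) \<in> R ^^ m}" k d] assms
  unfolding period_def by (auto intro: relpow_trans)

text \<open>Put a closed walk at \<open>i\<close> of length congruent to -d modulo k in front of the
  given walk. In the naturals, \<open>d * (k - 1)\<close> serves as -d.\<close>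

lemma relpow_rtrancl_if_gcd_dvd:
  assumes "k > 0" "(i, j) \<in> R ^^ d" "gcd k (period R i) dvd d"
  shows "(i, j) \<in> (R ^^ k)\<^sup>*"
proof -
  have "gcd k (period R i) dvd d * (k - 1)" using assms(3) by simp
  then obtain s where s: "(i, i) \<in> R ^^ s" "[s = d * (k - 1)] (mod k)"
    by (rule period_add_closed[OF \<open>k > 0\<close>])
  then have "[s + d = d * (k - 1) + d] (mod k)" by (intro cong_add) auto
  also have "d * (k - 1) + d = k * d" using \<open>k > 0\<close> by (cases k) (auto simp: algebra_simps)
  finally have "k dvd s + d" by (simp add: cong_def dvd_eq_mod_eq_0)
  then obtain m where "s + d = k * m" by blast
  moreover have "(i, j) \<in> R ^^ (s + d)" using s(1) assms(2) by (rule relpow_trans)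
  ultimately show ?thesis unfolding rtrancl_relpow_iff by metis
qed

text \<open>Closed walks of length \<open>m\<close> in \<open>R ^^ k\<close> are closed walks of
  length \<open>k * m\<close> in \<open>R\<close>. One divisibility cancels the coprime factor
  \<open>k div r\<close>; the other needs a closed walk of \<open>R\<close> whose length is
  prescribed modulo a multiple of \<open>k\<close>.\<close>

lemma period_relpow:
  assumes "k > 0"
  shows "period (R ^^ k) i = period R i div gcd k (period R i)"
proof (rule dvd_antisym)
  define r where "r = gcd k (period R i)"
  have r: "r > 0" "r dvd k" "r dvd period R i" using assms by (auto simp: r_def)
  define c where "c = period (R ^^ k) i"
  show "period R i div gcd k (period R i) dvd period (R ^^ k) i"
    unfolding period_def[of "R ^^ k"] relpow_mult
  proof (rule Gcd_greatest, clarify)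
    fix m assume "(i, i) \<in> R ^^ (k * m)"
    then have "period R i dvd k * m" by (rule period_dvd)
    then have "period R i div r dvd k div r * m"
      using r by (metis div_dvd_div dvd_mult2 dvd_div_mult)
    moreover have "coprime (period R i div r) (k div r)"
      using r assms by (metis div_gcd_coprime gcd.commute gcd_eq_0_iff not_gr0 r_def)
    ultimately show "period R i div gcd k (period R i) dvd m"
      by (simp add: coprime_dvd_mult_right_iff r_def)
  qed
  show "period (R ^^ k) i dvd period R i div gcd k (period R i)"
  \<comment> \<open>The modulus \<open>k * c\<close> used below must be positive. If
    \<open>c = 0\<close>, only the empty walk returns to \<open>i\<close> and both sides
    vanish.\<close>
  proof (cases "c = 0")
    case True
    have "period R i = 0"
      unfolding period_def[of R]
    proof (subst Gcd_0_iff, clarify)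
      fix m assume "(i, i) \<in> R ^^ m"
      then have "(i, i) \<in> (R ^^ k) ^^ m"
        unfolding relpow_mult by (metis mult.commute relpow_closed_mult)
      then have "c dvd m" unfolding c_def by (rule period_dvd)
      with True show "m = 0" by simp
    qed
    then show ?thesis by simp
  next
    case False
    \<comment> \<open>This is the least common multiple of \<open>k\<close> and the period. As a
      multiple of the period it is the length of a closed walk up to any positive modulus; the
      modulus \<open>k * c\<close> permits dividing the congruence by \<open>k\<close> and keeping
      one modulo \<open>c\<close>.\<close>
    define d where "d = k * (period R i div r)"
    have "d = period R i * (k div r)"
      using r by (metis d_def div_mult_swap mult.commute)
    then have "gcd (k * c) (period R i) dvd d" by simp
    then obtain s where s: "(i, i) \<in> R ^^ s" "[s = d] (mod (k * c))"
      using period_add_closed[of "k * c" R i d] assms False by auto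
    have "[s = d] (mod k)" using s(2) by (rule cong_modulus_mult_nat)
    then have "k dvd s" by (metis cong_dvd_iff d_def dvd_triv_left)
    then obtain m where m: "s = k * m" by blast
    then have "c dvd m" using s unfolding c_def by (intro period_dvd) (simp add: relpow_mult)
    moreover have "[m = period R i div r] (mod c)"
      using s(2) assms unfolding m d_def by (simp add: cong_def mult_mod_right[symmetric])
    ultimately show ?thesis by (metis c_def cong_dvd_iff cong_dvd_modulus r_def dvd_refl)
  qed
qed

text \<open>The hypothesis on successors provides walks from \<open>v\<close> of every length, so
  that all classes occur. It excludes a lone node without a loop, where the period is 0 and the gcd
  is \<open>k\<close> although there is just one node.\<close>

lemma cyclic_classes:
  assumes "k > 0" and V: "V = {j. (v, j) \<in> R\<^sup>*}" and ret: "\<And>j. j \<in> V \<Longrightarrow> (j, v) \<in> R\<^sup>*"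
    and succ: "\<And>i. i \<in> V \<Longrightarrow> \<exists>j. (i, j) \<in> R"
  shows "\<exists>h. h ` V = {..<gcd k (period R v)} \<and>
    (\<forall>i\<in>V. \<forall>j\<in>V. (i, j) \<in> (R ^^ k)\<^sup>* \<longleftrightarrow> h i = h j)"
proof -
  define r where "r = gcd k (period R v)"
  have r: "r > 0" "r dvd k" "r dvd period R v" using assms by (auto simp: r_def)
  \<comment> \<open>The choice of the walk is immaterial modulo \<open>r\<close>, since
    \<open>r\<close> divides the period; see \<open>f_cong\<close>.\<close>
  define f where "f = (\<lambda>j. SOME d. (v, j) \<in> R ^^ d)"
  have f: "(v, j) \<in> R ^^ f j" if "j \<in> V" for j
    using that someI_ex[of "\<lambda>d. (v, j) \<in> R ^^ d"] unfolding V f_def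
    by (auto simp: rtrancl_is_UN_relpow)
  have f_cong: "[d = f j] (mod r)" if "(v, j) \<in> R ^^ d" for j d
  proof -
    have "j \<in> V" using that by (auto simp: V relpow_imp_rtrancl)
    show ?thesis
      by (rule cong_dvd_modulus_nat[OF period_cong_relpow[OF that f[OF \<open>j \<in> V\<close>] ret[OF \<open>j \<in> V\<close>]] r(3)])
  qed
  show ?thesis
  proof (intro exI[of _ "\<lambda>j. f j mod r"] conjI ballI)
    show "(\<lambda>j. f j mod r) ` V = {..<gcd k (period R v)}"
      unfolding r_def[symmetric]
    proof (intro equalityI subsetI)
      fix c assume "c \<in> {..<r}"
      have "\<exists>j. (v, j) \<in> R ^^ c"
      proof (induction c)
        case (Suc c)
        then obtain j where j: "(v, j) \<in> R ^^ c" by auto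
        then obtain l where "(j, l) \<in> R" using succ[of j] by (auto simp: V relpow_imp_rtrancl)
        with j show ?case by auto
      qed auto
      then obtain j where j: "(v, j) \<in> R ^^ c" by auto
      then have "c = f j mod r" using f_cong[OF j] \<open>c \<in> _\<close> by (simp add: cong_def)
      moreover have "j \<in> V" using j by (auto simp: V relpow_imp_rtrancl)
      ultimately show "c \<in> (\<lambda>j. f j mod r) ` V" by blast
    qed (use r in auto)
    fix i j assume ij: "i \<in> V" "j \<in> V"
    show "(i, j) \<in> (R ^^ k)\<^sup>* \<longleftrightarrow> f i mod r = f j mod r"
    proof
      assume "(i, j) \<in> (R ^^ k)\<^sup>*"
      then obtain m where "(i, j) \<in> R ^^ (k * m)" by (auto simp: rtrancl_relpow_iff)
      then have "[f i + k * m = f j] (mod r)" by (rule f_cong[OF relpow_trans[OF f[OF ij(1)]]])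
      moreover have "[f i + k * m = f i + 0] (mod r)"
        using r by (intro cong_add) (auto simp: cong_0_iff)
      ultimately show "f i mod r = f j mod r" by (simp add: cong_def)
    next
      assume eq: "f i mod r = f j mod r"
      have "(i, j) \<in> R\<^sup>*" using ij ret by (auto simp: V intro: rtrancl_trans)
      then obtain d where d: "(i, j) \<in> R ^^ d" by (auto simp: rtrancl_is_UN_relpow)
      then have "[f i + d = f j] (mod r)" by (rule f_cong[OF relpow_trans[OF f[OF ij(1)]]])
      then have "[f i + d = f i] (mod r)" using eq by (simp add: cong_def)
      then have "r dvd d" by (simp add: cong_add_lcancel_0_nat cong_0_iff)
      moreover have "period R i = period R v" using ij ret by (intro period_eq) (simp_all add: V)
      ultimately show "(i, j) \<in> (R ^^ k)\<^sup>*"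
        using relpow_rtrancl_if_gcd_dvd[OF \<open>k > 0\<close> d] by (simp add: r_def)
    qed
  qed
qed

text \<open>Walks that start in \<open>W\<close> never leave it, so they lift along the bijection.
  This serves three times: with the identity to restrict to a component, with an enumeration of a
  class to describe a diagonal block, and with a permutation to describe a conjugate matrix.\<close>

lemma relpow_pullback:
  assumes "bij_betw \<rho> D W" and closed: "\<And>u v. u \<in> W \<Longrightarrow> (u, v) \<in> R \<Longrightarrow> v \<in> W" and "a \<in> D"
  shows "(a, b) \<in> {(a, b). a \<in> D \<and> b \<in> D \<and> (\<rho> a, \<rho> b) \<in> R} ^^ m
    \<longleftrightarrow> b \<in> D \<and> (\<rho> a, \<rho> b) \<in> R ^^ m"
proof (induction m arbitrary: b)
  case 0
  then show ?case using assms(1,3) by (auto simp: bij_betw_def dest: inj_onD)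
next
  case (Suc m)
  have "u \<in> W" if "(\<rho> a, u) \<in> R ^^ m" for m u
    using that
  proof (induction m arbitrary: u)
    case 0
    then show ?case using assms(1,3) by (auto simp: bij_betw_def)
  next
    case (Suc m)
    then show ?case using closed by auto
  qed
  moreover have "W = \<rho> ` D" using assms(1) by (simp add: bij_betw_def)
  ultimately have "u \<in> \<rho> ` D" if "(\<rho> a, u) \<in> R ^^ m" for u
    using that by blast
  note preimage = this
  show ?case
  proof
    assume "(a, b) \<in> {(a, b). a \<in> D \<and> b \<in> D \<and> (\<rho> a, \<rho> b) \<in> R} ^^ Suc m"
    then show "b \<in> D \<and> (\<rho> a, \<rho> b) \<in> R ^^ Suc m" using Suc.IH by auto
  next
    assume b: "b \<in> D \<and> (\<rho> a, \<rho> b) \<in> R ^^ Suc m"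
    then obtain u where u: "(\<rho> a, u) \<in> R ^^ m" "(u, \<rho> b) \<in> R" by auto
    then obtain d where "d \<in> D" "u = \<rho> d" using preimage by blast
    with u b Suc.IH show "(a, b) \<in> {(a, b). a \<in> D \<and> b \<in> D \<and> (\<rho> a, \<rho> b) \<in> R} ^^ Suc m"
      by (intro relpow_Suc_I[of _ d]) auto
  qed
qed

lemma period_pullback:
  assumes "bij_betw \<rho> D W" "\<And>u v. u \<in> W \<Longrightarrow> (u, v) \<in> R \<Longrightarrow> v \<in> W" "a \<in> D"
  shows "period {(a, b). a \<in> D \<and> b \<in> D \<and> (\<rho> a, \<rho> b) \<in> R} a = period R (\<rho> a)"
  using relpow_pullback[OF assms, where b = a] assms(3) by (simp add: period_def)

lemma rtrancl_pullback:
  assumes "bij_betw \<rho> D W" "\<And>u v. u \<in> W \<Longrightarrow> (u, v) \<in> R \<Longrightarrow> v \<in> W" "a \<in> D" "b \<in> D"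
  shows "(a, b) \<in> {(a, b). a \<in> D \<and> b \<in> D \<and> (\<rho> a, \<rho> b) \<in> R}\<^sup>* \<longleftrightarrow> (\<rho> a, \<rho> b) \<in> R\<^sup>*"
  using relpow_pullback[OF assms(1-3), where b = b] assms(4) by (simp add: rtrancl_is_UN_relpow)

subsection \<open>Closed walks and cyclicity of digraphs\<close>

lemma (in pair_wf_digraph) awalk_imp_relpow:
  "awalk u p v \<Longrightarrow> (u, v) \<in> parcs G ^^ length p"
proof (induction p arbitrary: u)
  case (Cons e p)
  then show ?case
    by (cases e) (auto simp: awalk_Cons_iff simp del: relpow.simps(2) intro: relpow_Suc_I2)
qed (simp add: awalk_Nil_iff)

lemma (in pair_wf_digraph) relpow_imp_awalk:
  assumes "(u, v) \<in> parcs G ^^ m" "u \<in> pverts G"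
  obtains p where "awalk u p v" "length p = m"
proof -
  have "\<exists>p. awalk u p v \<and> length p = m"
    using assms
  proof (induction m arbitrary: u)
    case 0
    then show ?case by (auto simp: awalk_Nil_iff)
  next
    case (Suc m)
    then obtain w where w: "(u, w) \<in> parcs G" "(w, v) \<in> parcs G ^^ m"
      by (blast elim: relpow_Suc_E2)
    then obtain p where "awalk w p v" "length p = m"
      using Suc.IH in_arcsD2 by blast
    with w show ?case
      by (intro exI[of _ "(u, w) # p"]) (auto simp: awalk_Cons_iff)
  qed
  then show thesis using that by blast
qed

lemma (in pair_wf_digraph) reachable_iff_rtrancl:
  "u \<rightarrow>\<^sup>*\<^bsub>with_proj G\<^esub> v \<longleftrightarrow> u \<in> pverts G \<and> (u, v) \<in> (parcs G)\<^sup>*"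
proof
  assume "u \<rightarrow>\<^sup>*\<^bsub>with_proj G\<^esub> v"
  then show "u \<in> pverts G \<and> (u, v) \<in> (parcs G)\<^sup>*"
    unfolding reachable_awalk by (auto dest: awalk_imp_relpow relpow_imp_rtrancl)
next
  assume "u \<in> pverts G \<and> (u, v) \<in> (parcs G)\<^sup>*"
  then show "u \<rightarrow>\<^sup>*\<^bsub>with_proj G\<^esub> v"
    unfolding reachable_awalk by (meson relpow_imp_awalk rtrancl_imp_relpow)
qed

text \<open>Reduces closed walks to elementary cycles: a closed walk that repeats a node contains a
  shorter nonempty closed walk that can be cut out. It yields both the gcd of closed walk lengths
  and the weight bound for closed walks.\<close>

lemma (in pair_wf_digraph) closed_awalk_induct [consumes 1, case_names Nil cycle splice]:
  assumes "awalk u p u" and "P []" and "\<And>p. cycle p \<Longrightarrow> P p"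
    and splice: "\<And>q r s. P r \<Longrightarrow> P (q @ s) \<Longrightarrow> P (q @ r @ s)"
  shows "P p"
  using assms(1)
proof (induction "length p" arbitrary: u p rule: less_induct)
  case less
  show ?case
  proof (cases "p = [] \<or> distinct (tl (awalk_verts u p))")
    case True
    then show ?thesis using assms(2) assms(3)[of p] less.prems by (fastforce simp: cycle_def)
  next
    case False
    \<comment> \<open>The first arc is set aside because the start node of a closed walk always
      recurs at its end; only a repetition among the later nodes can be cut out.\<close>
    then obtain e es where p: "p = e # es" by (cases p) auto
    with less.prems have es: "awalk (snd e) es u" "e \<in> parcs G" "fst e = u"
      by (auto simp: awalk_Cons_iff)
    have "\<not> distinct (awalk_verts (snd e) es)" using False p by auto
    from awalk_not_distinct_decomp[OF es(1) this] obtain q r s w where qrs: "es = q @ r @ s"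
      "0 < length r" "awalk (snd e) q w" "awalk w r w" "awalk w s u"
      by blast
    then have "P r" using p by (intro less.hyps) auto
    have "awalk u (e # q @ s) u"
      using qrs es by (auto simp: awalk_Cons_iff intro: awalk_appendI)
    then have "P (e # q @ s)" using p qrs by (intro less.hyps) auto
    with \<open>P r\<close> show ?thesis using splice[of r "e # q" s] p qrs by simp
  qed
qed

lemma (in pair_wf_digraph) dvd_length_closed_awalk:
  assumes "awalk u p u" "\<And>p. cycle p \<Longrightarrow> g dvd length p"
  shows "(g :: nat) dvd length p"
  using assms(1)
proof (induction rule: closed_awalk_induct)
  case (splice q r s)
  then have "g dvd length r + length (q @ s)" by (rule dvd_add)
  then show ?case by (simp add: add_ac)
qed (use assms(2) in auto)

text \<open>Closed walks are spliced from elementary cycles, so the gcd of the cycle lengths divides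
  their lengths. Conversely a cycle is a closed walk at its own start node, and strong connectivity
  makes the period the same at all nodes.\<close>

lemma (in pair_wf_digraph) cyclicity_eq_period:
  assumes "v \<in> pverts G" "\<And>u. u \<in> pverts G \<Longrightarrow> (u, v) \<in> (parcs G)\<^sup>* \<and> (v, u) \<in> (parcs G)\<^sup>*"
  shows "cyclicity (with_proj G) = period (parcs G) v"
proof (rule dvd_antisym)
  show "cyclicity (with_proj G) dvd period (parcs G) v"
    unfolding period_def
  proof (rule Gcd_greatest, clarify)
    fix m assume "(v, v) \<in> parcs G ^^ m"
    then obtain p where "awalk v p v" "length p = m" using assms(1) by (rule relpow_imp_awalk)
    then show "cyclicity (with_proj G) dvd m"
      using dvd_length_closed_awalk[of v p "cyclicity (with_proj G)"]
      by (auto simp: cyclicity_def intro: Gcd_dvd)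
  qed
  show "period (parcs G) v dvd cyclicity (with_proj G)"
    unfolding cyclicity_def
  proof (rule Gcd_greatest, clarify)
    fix p assume "cycle p"
    then obtain u where u: "awalk u p u" by (auto simp: cycle_def)
    then have "period (parcs G) u dvd length p" by (intro period_dvd awalk_imp_relpow)
    moreover have "u \<in> pverts G" using u by (rule awalk_hd_in_verts)
    ultimately show "period (parcs G) v dvd length p"
      using assms(2) period_eq by metis
  qed
qed

text \<open>If reachability is symmetric, as in a critical graph, the component of \<open>v\<close>
  is all that \<open>v\<close> reaches. No walk leaves it, so its cyclicity can be read off from the
  whole graph.\<close>

lemma (in pair_wf_digraph) sccs_if_rtrancl_sym:
  assumes "\<And>i j. (i, j) \<in> (parcs G)\<^sup>* \<Longrightarrow> (j, i) \<in> (parcs G)\<^sup>*" "C \<in> sccs"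
  obtains v where "v \<in> pverts G" "verts C = {j. (v, j) \<in> (parcs G)\<^sup>*}"
    "cyclicity C = period (parcs G) v"
proof -
  have "verts C \<in> scc_of ` pverts G"
    using assms(2) sccs_verts_conv sccs_verts_conv_scc_of by auto
  then obtain v where v: "v \<in> pverts G" "verts C = scc_of v" by (rule imageE)
  define V where "V = {j. (v, j) \<in> (parcs G)\<^sup>*}"
  have closed: "b \<in> V" if "a \<in> V" "(a, b) \<in> parcs G" for a b
    using that by (auto simp: V_def)
  have "v \<in> V" by (simp add: V_def)
  have "V \<subseteq> pverts G"
    using v(1) by (auto simp: V_def elim: rtranclE dest: in_arcsD2)
  then have V: "verts C = V"
    using assms(1) unfolding v(2) scc_of_def reachable_iff_rtrancl V_def using v(1) by blast
  define H where "H = \<lparr>pverts = V, parcs = {(a, b). a \<in> V \<and> b \<in> V \<and> (id a, id b) \<in> parcs G}\<rparr>"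
  have "induced_subgraph C (with_proj G)" using assms(2) by (rule in_sccs_imp_induced)
  then have C: "C = with_proj H"
    using V by (auto simp: induced_subgraph_def subgraph_def compatible_def with_proj_def H_def
        intro!: pre_digraph.equality)
  interpret H: pair_wf_digraph H by unfold_locales (auto simp: H_def)
  have "(a, b) \<in> (parcs H)\<^sup>*" if "a \<in> V" "b \<in> V" for a b
  proof -
    have "(a, b) \<in> (parcs G)\<^sup>*"
      using that assms(1) unfolding V_def by (blast intro: rtrancl_trans)
    then show ?thesis
      using rtrancl_pullback[OF bij_betw_id closed that] by (simp add: H_def)
  qed
  then have "cyclicity (with_proj H) = period (parcs H) v"
    using \<open>v \<in> V\<close> by (intro H.cyclicity_eq_period) (simp_all add: H_def)
  also have "\<dots> = period (parcs G) v"
    using period_pullback[OF bij_betw_id closed \<open>v \<in> V\<close>] by (simp add: H_def)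
  finally show thesis using that v(1) V C unfolding V_def by blast
qed

subsection \<open>Subeigenvectors and the critical graph\<close>

lemma pair_fin_digraph_mat_digraph:
  assumes "B \<in> carrier_mat n n"
  shows "pair_fin_digraph (mat_digraph B)"
proof
  show "finite (parcs (mat_digraph B))"
    by (rule finite_subset[of _ "{0..<dim_row B} \<times> {0..<dim_col B}"]) (auto simp: mat_digraph_def)
qed (use assms in \<open>auto simp: mat_digraph_def\<close>)

lemma mat_digraph_simps:
  assumes "B \<in> carrier_mat n n"
  shows "pverts (mat_digraph B) = {0..<n}"
    "parcs (mat_digraph B) = {(i, j). i < n \<and> j < n \<and> B $$ (i, j) \<noteq> 0}"
  using assms by (auto simp: mat_digraph_def)

lemma finite_mat_cycles:
  assumes "B \<in> carrier_mat n n"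
  shows "finite {p. mat_cycle B p}"
proof -
  interpret pair_fin_digraph "mat_digraph B" using assms by (rule pair_fin_digraph_mat_digraph)
  have "{p. mat_cycle B p} \<subseteq> {p. set p \<subseteq> parcs (mat_digraph B) \<and> distinct p}"
    by (auto simp: cycle_conv)
  then show ?thesis
    using finite_subset_distinct[OF pair_finite_arcs] by (rule finite_subset)
qed

lemma path_weight_simps [simp]:
  "path_weight A [] = 1"
  "path_weight A (e # p) = A $$ e * path_weight A p"
  "path_weight A (p @ q) = path_weight A p * path_weight A q"
  by (simp_all add: path_weight_def)

lemma path_weight_nonneg:
  assumes "nonneg_mat A" "set p \<subseteq> parcs (mat_digraph A)"
  shows "0 \<le> path_weight A p"
  using assms(2)
proof (induction p)
  case (Cons e p)
  then have "0 \<le> A $$ e" using assms(1) by (auto simp: nonneg_mat_def mat_digraph_def)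
  with Cons show ?case by simp
qed simp

text \<open>Equivalently, x is a positive diagonal scaling after which every entry b_ij x_j / x_i is
  at most \<mu>.\<close>

definition subeigenvector :: "real mat \<Rightarrow> nat \<Rightarrow> (nat \<Rightarrow> real) \<Rightarrow> real \<Rightarrow> bool" where
  "subeigenvector B n x \<mu> \<longleftrightarrow>
     (\<forall>i<n. 0 < x i) \<and> (\<forall>i<n. \<forall>j<n. B $$ (i, j) * x j \<le> \<mu> * x i)"

definition saturation_graph :: "real mat \<Rightarrow> nat \<Rightarrow> (nat \<Rightarrow> real) \<Rightarrow> real \<Rightarrow> nat rel" where
  "saturation_graph B n x \<mu> = {(i, j). i < n \<and> j < n \<and> B $$ (i, j) * x j = \<mu> * x i}"

lemma rtrancl_if_awalk_subset:
  assumes "B \<in> carrier_mat n n" "pre_digraph.awalk (mat_digraph B) u p v" "set p \<subseteq> R"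
  shows "(u, v) \<in> R\<^sup>*"
proof -
  interpret pair_fin_digraph "mat_digraph B" using assms(1) by (rule pair_fin_digraph_mat_digraph)
  show ?thesis
    using assms(2,3)
  proof (induction p arbitrary: u)
    case (Cons e p)
    then have "(u, snd e) \<in> R" "(snd e, v) \<in> R\<^sup>*"
      by (auto simp: awalk_Cons_iff)
    then show ?case by (rule converse_rtrancl_into_rtrancl)
  qed (simp add: awalk_Nil_iff)
qed

text \<open>Instantiated with \<open>A\<close>, with its power and with a permuted conjugate of a
  matrix. That \<mu> is the maximum cycle mean is not assumed; it follows once the saturation graph
  has a closed walk.\<close>

locale subeigen =
  fixes B :: "real mat" and n :: nat and x :: "nat \<Rightarrow> real" and \<mu> :: real
  assumes carrier: "B \<in> carrier_mat n n" and nonneg: "nonneg_mat B"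
    and pos: "\<mu> > 0" and sub: "subeigenvector B n x \<mu>"
begin

abbreviation S :: "nat rel" where "S \<equiv> saturation_graph B n x \<mu>"

sublocale D: pair_fin_digraph "mat_digraph B"
  using carrier by (rule pair_fin_digraph_mat_digraph)

lemmas D_simps = mat_digraph_simps[OF carrier]

lemma x_pos: "i < n \<Longrightarrow> 0 < x i"
  using sub by (simp add: subeigenvector_def)

lemma entry_le: "i < n \<Longrightarrow> j < n \<Longrightarrow> B $$ (i, j) * x j \<le> \<mu> * x i"
  using sub by (simp add: subeigenvector_def)

lemma entry_nonneg: "i < n \<Longrightarrow> j < n \<Longrightarrow> 0 \<le> B $$ (i, j)"
  using nonneg carrier by (auto simp: nonneg_mat_def)

lemma saturation_graph_subset: "S \<subseteq> parcs (mat_digraph B)"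
  using pos x_pos by (fastforce simp: saturation_graph_def D_simps)

text \<open>The edge inequalities telescope along the walk. All factors being positive, equality of
  the products forces equality at every edge.\<close>

lemma awalk_weight:
  assumes "D.awalk u p v"
  shows "path_weight B p * x v \<le> \<mu> ^ length p * x u"
    and "path_weight B p * x v = \<mu> ^ length p * x u \<longleftrightarrow> set p \<subseteq> S"
proof -
  have "path_weight B p * x v \<le> \<mu> ^ length p * x u \<and>
    (path_weight B p * x v = \<mu> ^ length p * x u \<longleftrightarrow> set p \<subseteq> S)"
    using assms
  proof (induction p arbitrary: u)
    case (Cons e p)
    then obtain w where e: "e = (u, w)" "(u, w) \<in> parcs (mat_digraph B)" "D.awalk w p v"
      by (cases e) (auto simp: D.awalk_Cons_iff)
    then have uw: "u < n" "w < n" "B $$ (u, w) > 0"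
      using entry_nonneg by (fastforce simp: D_simps)+
    define W where "W = path_weight B p * x v"
    define M where "M = \<mu> ^ length p"
    have IH: "W \<le> M * x w" "W = M * x w \<longleftrightarrow> set p \<subseteq> S"
      using Cons.IH[OF e(3)] by (simp_all add: W_def M_def)
    have "M > 0" using pos by (simp add: M_def)
    have le1: "B $$ (u, w) * W \<le> B $$ (u, w) * (M * x w)" using IH uw by simp
    have eq1: "B $$ (u, w) * W = B $$ (u, w) * (M * x w) \<longleftrightarrow> W = M * x w" using uw by simp
    have le2: "M * (B $$ (u, w) * x w) \<le> M * (\<mu> * x u)"
      using entry_le[OF uw(1,2)] \<open>M > 0\<close> by simp
    have eq2: "M * (B $$ (u, w) * x w) = M * (\<mu> * x u) \<longleftrightarrow> (u, w) \<in> S"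
      using \<open>M > 0\<close> uw by (simp add: saturation_graph_def)
    have l: "path_weight B (e # p) * x v = B $$ (u, w) * W"
      and r: "\<mu> ^ length (e # p) * x u = M * (\<mu> * x u)"
      and m: "B $$ (u, w) * (M * x w) = M * (B $$ (u, w) * x w)"
      by (simp_all add: e W_def M_def)
    \<comment> \<open>The outer terms of the chain formed by \<open>le1\<close>, \<open>m\<close>
      and \<open>le2\<close> agree exactly if both inequalities are equalities.\<close>
    have "B $$ (u, w) * W = M * (\<mu> * x u) \<longleftrightarrow>
      B $$ (u, w) * W = B $$ (u, w) * (M * x w) \<and> M * (B $$ (u, w) * x w) = M * (\<mu> * x u)"
      using le1 le2 m by linarith
    then have "B $$ (u, w) * W = M * (\<mu> * x u) \<longleftrightarrow> set (e # p) \<subseteq> S"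
      unfolding eq1 eq2 IH(2) e(1) by auto
    moreover have "B $$ (u, w) * W \<le> M * (\<mu> * x u)" using le1 le2 m by linarith
    ultimately show ?case unfolding l r by blast
  qed (simp add: D.awalk_Nil_iff)
  then show "path_weight B p * x v \<le> \<mu> ^ length p * x u"
    "path_weight B p * x v = \<mu> ^ length p * x u \<longleftrightarrow> set p \<subseteq> S" by auto
qed

lemma cycle_mean_le:
  assumes "mat_cycle B p"
  shows "cycle_mean B p \<le> \<mu>" and "cycle_mean B p = \<mu> \<longleftrightarrow> set p \<subseteq> S"
proof -
  obtain u where u: "D.awalk u p u" "p \<noteq> []" using assms by (auto simp: D.cycle_def)
  then have "x u > 0" using x_pos D.awalk_hd_in_verts[OF u(1)] by (simp add: D_simps)
  then have le: "path_weight B p \<le> \<mu> ^ length p"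
    and eq: "path_weight B p = \<mu> ^ length p \<longleftrightarrow> set p \<subseteq> S"
    using awalk_weight[OF u(1)] by simp_all
  have root: "root (length p) (\<mu> ^ length p) = \<mu>"
    using pos u(2) by (simp add: real_root_power_cancel)
  show "cycle_mean B p \<le> \<mu>"
    unfolding cycle_mean_def using u(2) le by (subst root[symmetric]) simp
  show "cycle_mean B p = \<mu> \<longleftrightarrow> set p \<subseteq> S"
    using u(2) eq real_root_eq_iff[of "length p" "path_weight B p" "\<mu> ^ length p"]
    by (simp add: cycle_mean_def root)
qed

text \<open>Critical cycles must be elementary, so the return walk is first shortened to a path and
  only then closed by the edge.\<close>

lemma cycle_through_cyclic_part:
  assumes "(i, j) \<in> cyclic_part S"
  obtains p where "mat_cycle B p" "set p \<subseteq> S" "(i, j) \<in> set p"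
proof -
  define G where "G = \<lparr>pverts = {0..<n}, parcs = S\<rparr>"
  interpret G: pair_wf_digraph G
    by unfold_locales (auto simp: G_def saturation_graph_def)
  have ij: "(i, j) \<in> parcs G" "(j, i) \<in> (parcs G)\<^sup>*"
    using assms by (auto simp: cyclic_part_def G_def)
  then have "j \<rightarrow>\<^sup>*\<^bsub>with_proj G\<^esub> i" using G.reachable_iff_rtrancl G.in_arcsD2 by blast
  then obtain q where q: "G.apath j q i" using G.reachable_apath by blast
  then have "G.awalk i ((i, j) # q) i" "distinct (tl (G.awalk_verts i ((i, j) # q)))"
    using ij by (auto simp: G.apath_def G.awalk_Cons_iff)
  then have "G.cycle ((i, j) # q)" by (auto simp: G.cycle_def)
  moreover have "subgraph (with_proj G) (with_proj (mat_digraph B))"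
    using saturation_graph_subset G.wf_digraph_axioms D.wf_digraph_axioms
    by (simp add: subgraph_def compatible_def G_def D_simps(1))
  ultimately have "mat_cycle B ((i, j) # q)" by (rule_tac D.subgraph_cycle)
  moreover have "set ((i, j) # q) \<subseteq> parcs G"
    using q ij by (auto simp: G.apath_def G.awalk_def)
  then have "set ((i, j) # q) \<subseteq> S" by (simp add: G_def)
  ultimately show thesis using that by simp
qed

lemma cycle_subset_cyclic_part:
  assumes "mat_cycle B p" "set p \<subseteq> S"
  shows "set p \<subseteq> cyclic_part S"
proof
  fix e assume e: "e \<in> set p"
  obtain u where u: "D.awalk u p u" using assms by (auto simp: D.cycle_def)
  obtain q r where p: "p = q @ e # r" using e by (auto simp: in_set_conv_decomp)
  with u have "D.awalk u q (fst e)" "D.awalk (snd e) r u"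
    by (auto simp: D.awalk_Cons_iff dest: D.awalk_ends_eqD)
  then have "(u, fst e) \<in> S\<^sup>*" "(snd e, u) \<in> S\<^sup>*"
    using assms(2) p by (auto intro: rtrancl_if_awalk_subset[OF carrier])
  then have "(snd e, fst e) \<in> S\<^sup>*" by (rule_tac rtrancl_trans)
  then show "e \<in> cyclic_part S" using assms(2) e by (cases e) (auto simp: cyclic_part_def)
qed

text \<open>An edge of the cyclic part lies on an elementary cycle that attains the bound \<mu>; the
  critical cycles are then the cycles made of saturated edges.\<close>

lemma
  assumes "cyclic_part S \<noteq> {}"
  shows max_cycle_mean_eq: "max_cycle_mean B = \<mu>"
    and parcs_critical_graph: "parcs (critical_graph B) = cyclic_part S"
    and pverts_critical_graph: "pverts (critical_graph B) = Field (cyclic_part S)"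
proof -
  obtain i j where "(i, j) \<in> cyclic_part S" using assms by auto
  then obtain p where p: "mat_cycle B p" "set p \<subseteq> S" by (rule cycle_through_cyclic_part)
  have "Max (cycle_mean B ` {p. mat_cycle B p}) = \<mu>"
  proof (rule Max_eqI)
    show "finite (cycle_mean B ` {p. mat_cycle B p})" using finite_mat_cycles[OF carrier] by simp
    have "cycle_mean B p = \<mu>" using cycle_mean_le(2)[OF p(1)] p(2) by simp
    then show "\<mu> \<in> cycle_mean B ` {p. mat_cycle B p}" using p(1) by blast
  qed (auto intro: cycle_mean_le(1))
  with p show mean: "max_cycle_mean B = \<mu>" by (auto simp: max_cycle_mean_def)
  have crit: "critical_cycle B p \<longleftrightarrow> mat_cycle B p \<and> set p \<subseteq> S" for p
    using cycle_mean_le(2) by (auto simp: critical_cycle_def mean)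
  show parcs: "parcs (critical_graph B) = cyclic_part S"
  proof (intro equalityI subsetI)
    fix e assume "e \<in> cyclic_part S"
    then show "e \<in> parcs (critical_graph B)"
      unfolding critical_graph_def crit by (cases e) (auto elim: cycle_through_cyclic_part)
  qed (use cycle_subset_cyclic_part in \<open>auto simp: critical_graph_def crit\<close>)
  have "pverts (critical_graph B) = Field (parcs (critical_graph B))"
    unfolding critical_graph_def Field_def by force
  then show "pverts (critical_graph B) = Field (cyclic_part S)" by (simp add: parcs)
qed

end

text \<open>\<open>x u\<close> is the largest scaled weight of an elementary path from
  \<open>u\<close>, with free end: a row maximum of the Kleene star of the scaled matrix. Elementary
  paths are finite in number, and by the cycle bound cutting out a closed part never lowers the
  weight, so x also bounds the walks obtained by putting an edge in front.\<close>

lemma subeigenvector_exists: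
  assumes carrier: "A \<in> carrier_mat n n" and nonneg: "nonneg_mat A" and "\<mu> > 0"
    and cycles: "\<And>p. mat_cycle A p \<Longrightarrow> path_weight A p \<le> \<mu> ^ length p"
  obtains x where "subeigenvector A n x \<mu>"
proof -
  interpret D: pair_fin_digraph "mat_digraph A"
    using carrier by (rule pair_fin_digraph_mat_digraph)
  note D_simps = mat_digraph_simps[OF carrier]
  define w where "w p = path_weight A p / \<mu> ^ length p" for p
  have w_append: "w (p @ q) = w p * w q" for p q
    by (simp add: w_def power_add)
  have w_nonneg: "0 \<le> w p" if "set p \<subseteq> parcs (mat_digraph A)" for p
    using path_weight_nonneg[OF nonneg that] \<open>\<mu> > 0\<close> by (simp add: w_def)
  have closed: "w p \<le> 1" if "D.awalk u p u" for u p
  proof -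
    \<comment> \<open>The inclusion travels through the induction because the splice case says
      nothing about its pieces being walks, and nonnegative weights require genuine arcs.\<close>
    have "set p \<subseteq> parcs (mat_digraph A) \<longrightarrow> w p \<le> 1"
      using that
    proof (induction rule: D.closed_awalk_induct)
      case (splice q r s)
      show ?case
      proof
        assume p: "set (q @ r @ s) \<subseteq> parcs (mat_digraph A)"
        have "w (q @ r @ s) = w (q @ s) * w r" by (simp add: w_append)
        also have "\<dots> \<le> 1"
          using splice p by (intro mult_le_one w_nonneg) auto
        finally show "w (q @ r @ s) \<le> 1" .
      qed
    qed (use cycles \<open>\<mu> > 0\<close> in \<open>auto simp: w_def\<close>)
    then show ?thesis using that by (auto simp: D.awalk_def)
  qed
  have apath: "\<exists>q. D.apath u q v \<and> w p \<le> w q" if "D.awalk u p v" for u p v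
    using that
  proof (induction rule: D.awalk_to_apath_induct)
    case (path p)
    then show ?case by (auto simp: D.apath_def)
  next
    case (decomp p q r s)
    then obtain z where p: "p = q @ r @ s" and z: "D.awalk u q z" "D.awalk z r z" "D.awalk z s v"
      using D.awalk_cyc_decompE[OF decomp(2,1,3)] by metis
    have "w p = w (q @ s) * w r" by (simp add: w_append p)
    also have "\<dots> \<le> w (q @ s) * 1"
      using closed[OF z(2)] z(1,3) by (intro mult_left_mono w_nonneg) (auto simp: D.awalk_def)
    finally have "w p \<le> w (q @ s)" by simp
    then show ?case using decomp(4) by (auto intro: order_trans)
  qed
  define W where "W u = w ` {q. \<exists>v. D.apath u q v}" for u
  have "finite {q. \<exists>v. D.apath u q v}" for u
    by (rule finite_surj[OF D.apaths_finite_triple, of _ "fst \<circ> snd"]) force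
  then have finite: "finite (W u)" for u by (simp add: W_def)
  define x where "x u = Max (W u)" for u
  have x_ge: "w q \<le> x u" if "D.apath u q v" for u q v
    unfolding x_def using that finite by (intro Max_ge) (auto simp: W_def)
  \<comment> \<open>The empty path has weight 1; this is the source of strict positivity.\<close>
  have x_ge_1: "1 \<le> x u" if "u < n" for u
    using x_ge[of u "[]" u] that by (simp add: D.apath_Nil_iff D_simps w_def)
  have "A $$ (i, j) * x j \<le> \<mu> * x i" if ij: "i < n" "j < n" for i j
  proof (cases "A $$ (i, j) = 0")
    case True
    then show ?thesis using x_ge_1[OF ij(1)] \<open>\<mu> > 0\<close> by simp
  next
    case False
    have "D.apath j [] j" using ij by (simp add: D.apath_Nil_iff D_simps)
    then have "x j \<in> W j" unfolding x_def by (intro Max_in finite) (auto simp: W_def)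
    then obtain q v where q: "D.apath j q v" "x j = w q" by (auto simp: W_def)
    then have "D.awalk i ((i, j) # q) v"
      using False ij by (simp add: D.apath_def D.awalk_Cons_iff D_simps)
    then obtain q' where "D.apath i q' v" "w ((i, j) # q) \<le> w q'" using apath by blast
    then have "w ((i, j) # q) \<le> x i" using x_ge by (meson order_trans)
    moreover have "w ((i, j) # q) = A $$ (i, j) * x j / \<mu>" using q by (simp add: w_def)
    ultimately show ?thesis using \<open>\<mu> > 0\<close> by (simp add: field_simps)
  qed
  moreover have "0 < x u" if "u < n" for u using x_ge_1[OF that] by simp
  ultimately show thesis using that[of x] by (simp add: subeigenvector_def)
qed

lemma max_cycle_mean_pos:
  assumes "nonneg_mat A" "A \<in> carrier_mat n n" "max_cycle_mean A \<noteq> 0"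
  obtains p where "mat_cycle A p" "cycle_mean A p = max_cycle_mean A" "max_cycle_mean A > 0"
    "\<And>p. mat_cycle A p \<Longrightarrow> path_weight A p \<le> max_cycle_mean A ^ length p"
proof -
  interpret D: pair_fin_digraph "mat_digraph A"
    using assms(2) by (rule pair_fin_digraph_mat_digraph)
  have ex: "\<exists>p. mat_cycle A p" using assms(3) by (auto simp: max_cycle_mean_def split: if_splits)
  then have max: "max_cycle_mean A = Max (cycle_mean A ` {p. mat_cycle A p})"
    by (simp add: max_cycle_mean_def)
  have fin: "finite (cycle_mean A ` {p. mat_cycle A p})"
    using finite_mat_cycles[OF assms(2)] by simp
  have "max_cycle_mean A \<in> cycle_mean A ` {p. mat_cycle A p}"
    unfolding max using ex fin by (intro Max_in) auto
  then obtain p where p: "mat_cycle A p" "cycle_mean A p = max_cycle_mean A" by auto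
  have weight: "0 \<le> path_weight A p" "p \<noteq> []" if "mat_cycle A p" for p
    using that assms(1) by (auto simp: D.cycle_def D.awalk_def intro: path_weight_nonneg)
  then have mean_nonneg: "0 \<le> cycle_mean A p" if "mat_cycle A p" for p
    using that by (simp add: cycle_mean_def real_root_ge_zero)
  have "max_cycle_mean A > 0" using p mean_nonneg assms(3) by (metis order_le_less)
  moreover have "path_weight A p \<le> max_cycle_mean A ^ length p" if "mat_cycle A p" for p
  proof -
    have "path_weight A p = cycle_mean A p ^ length p"
      using weight[OF that] by (simp add: cycle_mean_def)
    also have "cycle_mean A p \<le> max_cycle_mean A" unfolding max using that fin by (intro Max_ge) auto
    then have "cycle_mean A p ^ length p \<le> max_cycle_mean A ^ length p"
      using mean_nonneg[OF that] by (rule power_mono)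
    finally show ?thesis .
  qed
  ultimately show thesis using that p by blast
qed

subsection \<open>Max-algebraic powers and permutations\<close>

lemma max_mult_mat_carrier:
  "A \<in> carrier_mat n m \<Longrightarrow> B \<in> carrier_mat m l \<Longrightarrow> A \<otimes>\<^sub>m B \<in> carrier_mat n l"
  by (simp add: max_mult_mat_def)

text \<open>The 0 inserted under the maximum makes this true for factors of any sign.\<close>

lemma nonneg_max_mult_mat: "nonneg_mat (A \<otimes>\<^sub>m B)"
  by (simp add: nonneg_mat_def max_mult_mat_def)

lemma max_mult_mat_index:
  assumes "A \<in> carrier_mat n m" "B \<in> carrier_mat m l" "i < n" "j < l"
  shows "(A \<otimes>\<^sub>m B) $$ (i, j) = Max (insert 0 ((\<lambda>k. A $$ (i, k) * B $$ (k, j)) ` {0..<m}))"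
  using assms by (simp add: max_mult_mat_def)

lemma max_mult_mat_index_le_iff:
  assumes "A \<in> carrier_mat n m" "B \<in> carrier_mat m l" "i < n" "j < l"
  shows "(A \<otimes>\<^sub>m B) $$ (i, j) \<le> c \<longleftrightarrow> 0 \<le> c \<and> (\<forall>k<m. A $$ (i, k) * B $$ (k, j) \<le> c)"
  using max_mult_mat_index[OF assms] by auto

lemma max_mult_mat_index_ge_iff:
  assumes "A \<in> carrier_mat n m" "B \<in> carrier_mat m l" "i < n" "j < l"
  shows "c \<le> (A \<otimes>\<^sub>m B) $$ (i, j) \<longleftrightarrow> c \<le> 0 \<or> (\<exists>k<m. c \<le> A $$ (i, k) * B $$ (k, j))"
  using max_mult_mat_index[OF assms] by (auto simp: Max_ge_iff)

lemma max_pow_mat_carrier: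
  "A \<in> carrier_mat n n \<Longrightarrow> max_pow_mat A k \<in> carrier_mat n n"
  by (induction k) (auto intro: max_mult_mat_carrier)

lemma nonneg_max_pow_mat: "nonneg_mat (max_pow_mat A k)"
  using nonneg_max_mult_mat by (cases k) (auto simp: nonneg_mat_def[of "1\<^sub>m _"])

text \<open>A walk in the power is saturated exactly if its factors are, and a maximum reaches the
  bound exactly if one of its terms does. The condition \<open>i < n\<close> matters at exponent 0,
  where \<open>S ^^ 0\<close> is the identity on all naturals.\<close>

lemma (in subeigen)
  shows subeigen_max_pow_mat: "subeigen (max_pow_mat B k) n x (\<mu> ^ k)"
  and saturation_graph_max_pow_mat:
    "i < n \<Longrightarrow> (i, j) \<in> saturation_graph (max_pow_mat B k) n x (\<mu> ^ k) \<longleftrightarrow> (i, j) \<in> S ^^ k"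
proof -
  note pow_carrier = max_pow_mat_carrier[OF carrier]
  have pow_nonneg: "0 \<le> max_pow_mat B k $$ (i, j)" if "i < n" "j < n" for i j k
    using nonneg_max_pow_mat pow_carrier that unfolding nonneg_mat_def by (metis carrier_matD)
  have le: "max_pow_mat B k $$ (i, j) * x j \<le> \<mu> ^ k * x i" if "i < n" "j < n" for i j k
    using that(2)
  proof (induction k arbitrary: j)
    case 0
    then show ?case using x_pos that(1) carrier by (simp add: less_imp_le)
  next
    case (Suc k)
    have "max_pow_mat B k $$ (i, l) * B $$ (l, j) \<le> \<mu> ^ Suc k * x i / x j" if "l < n" for l
    proof -
      have "max_pow_mat B k $$ (i, l) * B $$ (l, j) * x j \<le> max_pow_mat B k $$ (i, l) * (\<mu> * x l)"
        using entry_le[OF that Suc.prems] pow_nonneg[OF \<open>i < n\<close> that]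
        by (simp add: mult.assoc mult_left_mono)
      also have "\<dots> = \<mu> * (max_pow_mat B k $$ (i, l) * x l)" by simp
      also have "\<dots> \<le> \<mu> * (\<mu> ^ k * x i)" using Suc.IH[OF that] pos by simp
      finally show ?thesis using x_pos[OF Suc.prems] by (simp add: field_simps)
    qed
    then have "max_pow_mat B (Suc k) $$ (i, j) \<le> \<mu> ^ Suc k * x i / x j"
      using \<open>i < n\<close> Suc.prems x_pos pos
      by (simp add: max_mult_mat_index_le_iff[OF pow_carrier carrier] less_imp_le)
    then show ?case using x_pos[OF Suc.prems] by (simp add: field_simps)
  qed
  show "subeigen (max_pow_mat B k) n x (\<mu> ^ k)"
    using pow_carrier nonneg_max_pow_mat pos x_pos le
    by unfold_locales (auto simp: subeigenvector_def)
  show "(i, j) \<in> saturation_graph (max_pow_mat B k) n x (\<mu> ^ k) \<longleftrightarrow> (i, j) \<in> S ^^ k" if "i < n"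
  proof (induction k arbitrary: j)
    case 0
    show ?case
      using that carrier x_pos[OF that] by (cases "j < n") (auto simp: saturation_graph_def)
  next
    case (Suc k)
    have step: "max_pow_mat B k $$ (i, l) * B $$ (l, j) * x j = \<mu> ^ Suc k * x i
      \<longleftrightarrow> (i, l) \<in> S ^^ k \<and> (l, j) \<in> S" if lj: "l < n" "j < n" for l
    proof -
      let ?p = "max_pow_mat B k $$ (i, l)"
      have le1: "?p * (B $$ (l, j) * x j) \<le> ?p * (\<mu> * x l)"
        using entry_le[OF lj] pow_nonneg[OF \<open>i < n\<close> lj(1)] by (simp add: mult_left_mono)
      have le2: "\<mu> * (?p * x l) \<le> \<mu> * (\<mu> ^ k * x i)" using le[OF \<open>i < n\<close> lj(1)] pos by simp
      have "?p * B $$ (l, j) * x j = \<mu> ^ Suc k * x i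
        \<longleftrightarrow> ?p * (B $$ (l, j) * x j) = ?p * (\<mu> * x l) \<and> \<mu> * (?p * x l) = \<mu> * (\<mu> ^ k * x i)"
      proof -
        have "?p * B $$ (l, j) * x j = ?p * (B $$ (l, j) * x j)"
          "\<mu> ^ Suc k * x i = \<mu> * (\<mu> ^ k * x i)" "?p * (\<mu> * x l) = \<mu> * (?p * x l)"
          by simp_all
        then show ?thesis using le1 le2 by linarith
      qed
      also have "\<dots> \<longleftrightarrow> ?p * (B $$ (l, j) * x j) = ?p * (\<mu> * x l) \<and> (i, l) \<in> S ^^ k"
        using Suc.IH[of l] pos lj \<open>i < n\<close>
        by (simp add: saturation_graph_def[of "max_pow_mat B k"])
      also have "\<dots> \<longleftrightarrow> (l, j) \<in> S \<and> (i, l) \<in> S ^^ k"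
      proof -
        \<comment> \<open>A saturated entry is positive, so it may be cancelled.\<close>
        have "?p \<noteq> 0" if "(i, l) \<in> S ^^ k"
          using that x_pos[OF \<open>i < n\<close>] pos unfolding Suc.IH[symmetric] saturation_graph_def[of "max_pow_mat B k"] by auto
        then show ?thesis using lj by (auto simp: saturation_graph_def)
      qed
      finally show ?thesis by blast
    qed
    show ?case
    proof (cases "j < n")
      case True
      \<comment> \<open>The upper bound is already known, so equality amounts to a lower bound;
        divided by \<open>x j\<close>, it is a lower bound on a maximum and hence the existence of
        one term.\<close>
      have "(i, j) \<in> saturation_graph (max_pow_mat B (Suc k)) n x (\<mu> ^ Suc k)
        \<longleftrightarrow> \<mu> ^ Suc k * x i / x j \<le> max_pow_mat B (Suc k) $$ (i, j)"
        using le[OF \<open>i < n\<close> True, of "Suc k"] x_pos[OF True] \<open>i < n\<close> True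
        by (auto simp: saturation_graph_def field_simps simp del: max_pow_mat.simps)
      also have "\<dots> \<longleftrightarrow> (\<exists>l<n. \<mu> ^ Suc k * x i / x j \<le> max_pow_mat B k $$ (i, l) * B $$ (l, j))"
      proof -
        \<comment> \<open>The bound is positive, so the default 0 in the maximum cannot attain
          it.\<close>
        have "\<not> \<mu> ^ Suc k * x i / x j \<le> 0"
          using x_pos[OF True] x_pos[OF \<open>i < n\<close>] pos by (simp add: not_le)
        then show ?thesis
          using max_mult_mat_index_ge_iff[OF pow_carrier carrier \<open>i < n\<close> True] by simp
      qed
      also have "\<dots> \<longleftrightarrow> (\<exists>l<n. max_pow_mat B k $$ (i, l) * B $$ (l, j) * x j = \<mu> ^ Suc k * x i)"
      proof -
        have "max_pow_mat B k $$ (i, l) * B $$ (l, j) * x j \<le> \<mu> ^ Suc k * x i" if "l < n" for l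
        proof -
          have "max_pow_mat B k $$ (i, l) * B $$ (l, j) \<le> max_pow_mat B (Suc k) $$ (i, j)"
            using max_mult_mat_index_ge_iff[OF pow_carrier carrier \<open>i < n\<close> True] that by auto
          then show ?thesis
            using le[OF \<open>i < n\<close> True, of "Suc k"] x_pos[OF True]
            by (meson mult_right_mono less_imp_le order_trans)
        qed
        then show ?thesis using x_pos[OF True] by (auto simp: pos_divide_le_eq intro: antisym)
      qed
      also have "\<dots> \<longleftrightarrow> (i, j) \<in> S ^^ Suc k"
        using step True by (auto simp: saturation_graph_def)
      finally show ?thesis .
    qed (auto simp: saturation_graph_def)
  qed
qed

section \<open>Boolean matrices of relations\<close>

definition rel_mat :: "nat \<Rightarrow> nat rel \<Rightarrow> real mat" where
  "rel_mat n E = mat n n (\<lambda>(i, j). if (i, j) \<in> E then 1 else 0)"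

lemma rel_mat_carrier: "rel_mat n E \<in> carrier_mat n n"
  by (simp add: rel_mat_def)

lemma max_pow_mat_rel_mat:
  assumes "E \<subseteq> {0..<n} \<times> {0..<n}"
  shows "max_pow_mat (rel_mat n E) k = rel_mat n (E ^^ k)"
proof (induction k)
  case 0
  show ?case by (auto simp: rel_mat_def)
next
  case (Suc k)
  show ?case
  proof (rule eq_matI)
    fix i j assume "i < dim_row (rel_mat n (E ^^ Suc k))" "j < dim_col (rel_mat n (E ^^ Suc k))"
    then have ij: "i < n" "j < n" by (simp_all add: rel_mat_def)
    have "max_pow_mat (rel_mat n E) (Suc k) $$ (i, j)
      = Max (insert 0 ((\<lambda>l. if (i, l) \<in> E ^^ k \<and> (l, j) \<in> E then 1 else 0) ` {0..<n}))"
      unfolding max_pow_mat.simps Suc.IH max_mult_mat_index[OF rel_mat_carrier rel_mat_carrier ij]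
      using ij by (intro arg_cong[of _ _ Max] arg_cong[of _ _ "insert 0"] image_cong)
        (auto simp: rel_mat_def)
    also have "\<dots> = (if (i, j) \<in> E ^^ Suc k then 1 else 0)"
    proof (rule Max_eqI)
      show "(if (i, j) \<in> E ^^ Suc k then 1 else 0 :: real) \<in>
        insert 0 ((\<lambda>l. if (i, l) \<in> E ^^ k \<and> (l, j) \<in> E then 1 else 0) ` {0..<n})"
      proof (cases "(i, j) \<in> E ^^ Suc k")
        case True
        then obtain l where "(i, l) \<in> E ^^ k" "(l, j) \<in> E" by auto
        with assms show ?thesis by (auto intro!: image_eqI[of _ _ l])
      qed simp
    qed (auto split: if_splits)
    finally show "max_pow_mat (rel_mat n E) (Suc k) $$ (i, j) = rel_mat n (E ^^ Suc k) $$ (i, j)"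
      using ij by (simp add: rel_mat_def)
  qed (use max_pow_mat_carrier[OF rel_mat_carrier, of n E "Suc k"] rel_mat_carrier[of n "E ^^ Suc k"]
      in \<open>simp_all only: carrier_matD\<close>)
qed

section \<open>Permutation matrices in max algebra\<close>

lemma Max_insert_0_single:
  fixes f :: "nat \<Rightarrow> real"
  assumes "k < n" "0 \<le> f k" "\<And>i. i < n \<Longrightarrow> i \<noteq> k \<Longrightarrow> f i = 0"
  shows "Max (insert 0 (f ` {0..<n})) = f k"
proof (rule Max_eqI)
  fix y assume "y \<in> insert 0 (f ` {0..<n})"
  then have "y = 0 \<or> y = f k" using assms(3) by (auto, metis)
  then show "y \<le> f k" using assms(2) by auto
qed (use assms in auto)

lemma max_mult_permutation_mat:
  assumes "B \<in> carrier_mat n n" "nonneg_mat B" "\<sigma> permutes {0..<n}" "i < n" "j < n"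
  shows "(B \<otimes>\<^sub>m permutation_mat n \<sigma>) $$ (i, j) = B $$ (i, \<sigma> j)"
    and "(permutation_mat n (Hilbert_Choice.inv \<sigma>) \<otimes>\<^sub>m B) $$ (i, j) = B $$ (\<sigma> i, j)"
proof -
  have lt: "\<sigma> l < n" if "l < n" for l using permutes_in_image[OF assms(3)] that by simp
  have nonneg: "0 \<le> B $$ (a, b)" if "a < n" "b < n" for a b
    using assms(1,2) that by (auto simp: nonneg_mat_def)
  have perm: "permutation_mat n \<tau> \<in> carrier_mat n n" for \<tau> by (simp add: permutation_mat_def)
  show "(B \<otimes>\<^sub>m permutation_mat n \<sigma>) $$ (i, j) = B $$ (i, \<sigma> j)"
    unfolding max_mult_mat_index[OF assms(1) perm assms(4,5)]
    using Max_insert_0_single[of "\<sigma> j" n "\<lambda>k. B $$ (i, k) * permutation_mat n \<sigma> $$ (k, j)"]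
      assms lt nonneg by (simp add: permutation_mat_def)
  have "i = Hilbert_Choice.inv \<sigma> k \<longleftrightarrow> k = \<sigma> i" for k
    using permutes_inverses[OF assms(3)] by metis
  then show "(permutation_mat n (Hilbert_Choice.inv \<sigma>) \<otimes>\<^sub>m B) $$ (i, j) = B $$ (\<sigma> i, j)"
    unfolding max_mult_mat_index[OF perm assms(1,4,5)]
    using Max_insert_0_single[of "\<sigma> i" n "\<lambda>k. permutation_mat n (Hilbert_Choice.inv \<sigma>) $$ (i, k) * B $$ (k, j)"]
      assms lt nonneg by (simp add: permutation_mat_def)
qed

lemma max_inverse_permutation_mat:
  assumes "\<sigma> permutes {0..<n}"
  shows "max_inverse_mat (permutation_mat n \<sigma>) (permutation_mat n (Hilbert_Choice.inv \<sigma>))"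
proof -
  let ?P = "permutation_mat n \<sigma>" and ?Q = "permutation_mat n (Hilbert_Choice.inv \<sigma>)"
  have c: "permutation_mat n \<tau> \<in> carrier_mat n n" "nonneg_mat (permutation_mat n \<tau>)" for \<tau>
    by (auto simp: permutation_mat_def nonneg_mat_def)
  have inv: "Hilbert_Choice.inv \<sigma> permutes {0..<n}" using assms by (rule permutes_inv)
  have inj: "\<sigma> i = \<sigma> j \<longleftrightarrow> i = j" "Hilbert_Choice.inv \<sigma> i = Hilbert_Choice.inv \<sigma> j \<longleftrightarrow> i = j" for i j
    using permutes_inj[OF assms] permutes_inj[OF inv] by (auto dest: injD)
  have lt: "\<sigma> l < n" "Hilbert_Choice.inv \<sigma> l < n" if "l < n" for l
    using permutes_in_image[OF assms] permutes_in_image[OF inv] that by simp_all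
  have "?P \<otimes>\<^sub>m ?Q = 1\<^sub>m n"
  proof (rule eq_matI)
    fix i j assume "i < dim_row (1\<^sub>m n)" "j < dim_col (1\<^sub>m n)"
    then have ij: "i < n" "j < n" by simp_all
    show "(?P \<otimes>\<^sub>m ?Q) $$ (i, j) = 1\<^sub>m n $$ (i, j)"
      using max_mult_permutation_mat(1)[OF c inv ij, of \<sigma>] lt ij permutes_inverses(1)[OF assms]
      by (simp add: permutation_mat_def)
  qed (simp_all add: max_mult_mat_def permutation_mat_def)
  moreover have "?Q \<otimes>\<^sub>m ?P = 1\<^sub>m n"
  proof (rule eq_matI)
    fix i j assume "i < dim_row (1\<^sub>m n)" "j < dim_col (1\<^sub>m n)"
    then have ij: "i < n" "j < n" by simp_all
    show "(?Q \<otimes>\<^sub>m ?P) $$ (i, j) = 1\<^sub>m n $$ (i, j)"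
      using max_mult_permutation_mat(2)[OF c assms ij, of \<sigma>] lt ij inj
      by (simp add: permutation_mat_def)
  qed (simp_all add: max_mult_mat_def permutation_mat_def)
  ultimately show ?thesis using c by (simp add: max_inverse_mat_def permutation_mat_def)
qed

subsection \<open>Block diagonal form of a component\<close>

text \<open>By monotonicity the class of the largest value is a final segment of the indices, which
  is split off as the last block. An empty class gives a block of size 0, so there are always
  exactly \<open>r\<close> blocks.\<close>

lemma diag_block_mat_of_monotone_classes:
  fixes g :: "nat \<Rightarrow> nat" and N :: "'a :: zero mat"
  assumes "N \<in> carrier_mat m m"
    and "\<And>i j. i \<le> j \<Longrightarrow> j < m \<Longrightarrow> g i \<le> g j" and "\<And>i. i < m \<Longrightarrow> g i < r"
    and "\<And>i j. i < m \<Longrightarrow> j < m \<Longrightarrow> g i \<noteq> g j \<Longrightarrow> N $$ (i, j) = 0"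
  shows "\<exists>Bs. N = diag_block_mat Bs \<and> length Bs = r \<and>
    (\<forall>B\<in>set Bs. \<exists>c<r. \<exists>s w. {a. a < m \<and> g a = c} = {s..<s + w} \<and>
      B = mat w w (\<lambda>(i, j). N $$ (s + i, s + j)))"
  using assms
proof (induction r arbitrary: m N)
  case 0
  then have "m = 0" by auto
  with 0 show ?case by (intro exI[of _ "[]"]) (auto intro!: eq_matI)
next
  case (Suc r)
  note N = \<open>N \<in> carrier_mat m m\<close> and mono = Suc.prems(2) and zero = Suc.prems(4)
  \<comment> \<open>The first index of the last class, or \<open>m\<close> if that class is
    empty.\<close>
  define l where "l = (LEAST a. a = m \<or> g a \<ge> r)"
  have l: "l = m \<or> g l \<ge> r" unfolding l_def by (rule LeastI[of _ m]) simp
  have l_le: "l \<le> m" unfolding l_def by (rule Least_le) simp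
  have below: "g a < r" if "a < l" for a
    using not_less_Least[of a "\<lambda>a. a = m \<or> g a \<ge> r"] that by (auto simp flip: l_def)
  have above: "g a = r" if "l \<le> a" "a < m" for a
    using l mono[OF that] Suc.prems(3)[OF that(2)] that by auto
  define L where "L = mat l l (\<lambda>(i, j). N $$ (i, j))"
  define B where "B = mat (m - l) (m - l) (\<lambda>(i, j). N $$ (l + i, l + j))"
  have "\<exists>Bs. L = diag_block_mat Bs \<and> length Bs = r \<and>
    (\<forall>B\<in>set Bs. \<exists>c<r. \<exists>s w. {a. a < l \<and> g a = c} = {s..<s + w} \<and>
      B = mat w w (\<lambda>(i, j). L $$ (s + i, s + j)))"
    using l_le mono zero below by (intro Suc.IH) (auto simp: L_def)
  then obtain Bs where Bs: "L = diag_block_mat Bs" "length Bs = r"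
    and blocks: "\<And>B. B \<in> set Bs \<Longrightarrow> \<exists>c<r. \<exists>s w. {a. a < l \<and> g a = c} = {s..<s + w} \<and>
      B = mat w w (\<lambda>(i, j). L $$ (s + i, s + j))"
    by blast
  have "N = four_block_mat L (0\<^sub>m l (m - l)) (0\<^sub>m (m - l) l) B"
  proof (rule eq_matI)
    fix i j assume "i < dim_row (four_block_mat L (0\<^sub>m l (m - l)) (0\<^sub>m (m - l) l) B)"
      "j < dim_col (four_block_mat L (0\<^sub>m l (m - l)) (0\<^sub>m (m - l) l) B)"
    then have ij: "i < m" "j < m" using l_le by (auto simp: L_def B_def)
    have "N $$ (i, j) = 0" if "i < l \<longleftrightarrow> \<not> j < l"
    proof (rule zero[OF ij])
      show "g i \<noteq> g j" using that below[of i] below[of j] above[of i] above[of j] ij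
        by (cases "i < l"; cases "j < l") auto
    qed
    then show "N $$ (i, j) = four_block_mat L (0\<^sub>m l (m - l)) (0\<^sub>m (m - l) l) B $$ (i, j)"
      using ij l_le by (auto simp: L_def B_def)
  qed (use N l_le in \<open>auto simp: L_def B_def\<close>)
  then have "N = diag_block_mat (Bs @ [B])"
    unfolding diag_block_mat_last Let_def Bs(1)[symmetric] by (simp add: L_def B_def)
  moreover have "\<exists>c<Suc r. \<exists>s w. {a. a < m \<and> g a = c} = {s..<s + w} \<and>
      B' = mat w w (\<lambda>(i, j). N $$ (s + i, s + j))" if "B' \<in> set (Bs @ [B])" for B'
  proof (cases "B' = B")
    case True
    have "{a. a < m \<and> g a = r} = {l..<l + (m - l)}"
      using above below l_le by (force simp: not_less[symmetric])
    with True show ?thesis unfolding B_def by blast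
  next
    case False
    then have "B' \<in> set Bs" using that by auto
    from blocks[OF this] obtain c s w where c: "c < r" "{a. a < l \<and> g a = c} = {s..<s + w}"
      and B': "B' = mat w w (\<lambda>(i, j). L $$ (s + i, s + j))"
      by blast
    have "a < m \<and> g a = c \<longleftrightarrow> a < l \<and> g a = c" for a
      using c(1) l_le above[of a] by (cases "a < l") auto
    then have "{a. a < m \<and> g a = c} = {s..<s + w}" using c(2) by simp
    moreover have "s + i < l" if "i < w" for i
    proof -
      have "s + i \<in> {a. a < l \<and> g a = c}" unfolding c(2) using that by simp
      then show ?thesis by simp
    qed
    then have "B' = mat w w (\<lambda>(i, j). N $$ (s + i, s + j))"
      unfolding B' by (intro eq_matI) (auto simp: L_def)
    ultimately show ?thesis using c(1) less_SucI by blast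
  qed
  ultimately show ?case using Bs(2) by (intro exI[of _ "Bs @ [B]"]) auto
qed

text \<open>Selection sort: the largest position receives an element with the largest key. It is
  applied with both sets equal to one component, which is thereby sorted in place.\<close>

lemma bij_betw_monotone_key:
  fixes U :: "'a :: linorder set" and h :: "'b \<Rightarrow> 'c :: linorder"
  assumes "finite U" "finite V" "card U = card V"
  shows "\<exists>\<tau>. bij_betw \<tau> U V \<and> (\<forall>i\<in>U. \<forall>j\<in>U. i \<le> j \<longrightarrow> h (\<tau> i) \<le> h (\<tau> j))"
  using assms
proof (induction "card U" arbitrary: U V)
  case 0
  then show ?case by (auto simp: bij_betw_def)
next
  case (Suc d)
  then have ne: "U \<noteq> {}" "V \<noteq> {}" by auto
  define u where "u = Max U"
  have u: "u \<in> U" "\<And>i. i \<in> U \<Longrightarrow> i \<le> u" using Suc.prems ne by (simp_all add: u_def)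
  have "Max (h ` V) \<in> h ` V" using Suc.prems ne by (intro Max_in) auto
  then obtain v where v: "v \<in> V" "h v = Max (h ` V)" by auto
  then have v_max: "h y \<le> h v" if "y \<in> V" for y using that Suc.prems by simp
  have "\<exists>\<tau>. bij_betw \<tau> (U - {u}) (V - {v}) \<and>
    (\<forall>i\<in>U - {u}. \<forall>j\<in>U - {u}. i \<le> j \<longrightarrow> h (\<tau> i) \<le> h (\<tau> j))"
    using Suc.hyps(2) Suc.prems u v by (intro Suc.hyps(1)) auto
  then obtain \<tau> where \<tau>: "bij_betw \<tau> (U - {u}) (V - {v})"
    and mono: "\<And>i j. i \<in> U - {u} \<Longrightarrow> j \<in> U - {u} \<Longrightarrow> i \<le> j \<Longrightarrow> h (\<tau> i) \<le> h (\<tau> j)"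
    by blast
  let ?\<tau> = "\<tau>(u := v)"
  have "bij_betw ?\<tau> (U - {u}) (V - {v})" using \<tau> bij_betw_cong[of "U - {u}" ?\<tau> \<tau>] by simp
  then have "bij_betw ?\<tau> ((U - {u}) \<union> {u}) ((V - {v}) \<union> {?\<tau> u})"
    by (intro notIn_Un_bij_betw) auto
  then have bij: "bij_betw ?\<tau> U V" using u(1) v(1) by (simp add: insert_absorb)
  have "h (?\<tau> i) \<le> h (?\<tau> j)" if "i \<in> U" "j \<in> U" "i \<le> j" for i j
  proof (cases "j = u")
    case True
    then show ?thesis using v_max bij that by (auto simp: bij_betw_def)
  next
    case False
    then have "i \<noteq> u" using u(2)[OF that(2)] that(3) by auto
    with False that show ?thesis using mono by auto
  qed
  with bij show ?case by blast
qed

text \<open>A single permutation has to sort all components at once. Disjointness allows the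
  rearrangements to be glued together, with the identity elsewhere.\<close>

lemma permutes_combine:
  assumes "finite S"
    and disj: "\<And>C D. C \<in> F \<Longrightarrow> D \<in> F \<Longrightarrow> V C \<inter> V D \<noteq> {} \<Longrightarrow> C = D"
    and sub: "\<And>C. C \<in> F \<Longrightarrow> V C \<subseteq> S" and bij: "\<And>C. C \<in> F \<Longrightarrow> bij_betw (\<tau> C) (V C) (V C)"
  shows "\<exists>\<sigma>. \<sigma> permutes S \<and> (\<forall>C\<in>F. \<forall>i\<in>V C. \<sigma> i = \<tau> C i)"
proof -
  let ?U = "\<Union> (V ` F)"
  define cl where "cl i = (SOME C. C \<in> F \<and> i \<in> V C)" for i
  have cl: "cl i = C" if "C \<in> F" "i \<in> V C" for C i
    using someI[of "\<lambda>C. C \<in> F \<and> i \<in> V C" C] disj[of "cl i" C] that unfolding cl_def by blast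
  define \<sigma> where "\<sigma> i = (if i \<in> ?U then \<tau> (cl i) i else i)" for i
  have \<sigma>: "\<sigma> i = \<tau> C i" if "C \<in> F" "i \<in> V C" for C i
    using cl[OF that] that by (auto simp: \<sigma>_def)
  have \<sigma>_in: "\<sigma> i \<in> V C" if "C \<in> F" "i \<in> V C" for C i
    using \<sigma>[OF that] bij_betwE[OF bij[OF that(1)]] that(2) by simp
  have out: "\<sigma> i = i" if "i \<notin> ?U" for i using that by (auto simp: \<sigma>_def)
  have "inj_on \<sigma> S"
  proof (rule inj_onI)
    fix i j assume eq: "\<sigma> i = \<sigma> j"
    show "i = j"
    proof (cases "i \<in> ?U \<and> j \<in> ?U")
      case True
      then obtain C D where CD: "C \<in> F" "i \<in> V C" "D \<in> F" "j \<in> V D" by auto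
      then have "C = D" using \<sigma>_in[of C i] \<sigma>_in[of D j] eq disj[of C D] by auto
      then show ?thesis
        using \<sigma>[of C i] \<sigma>[of D j] eq CD bij[of C] by (auto simp: bij_betw_def dest: inj_onD)
    next
      case False
      then show ?thesis using \<sigma>_in out eq by (metis UN_iff)
    qed
  qed
  moreover have "\<sigma> i \<in> S" if "i \<in> S" for i
    using that \<sigma>_in[of _ i] out[of i] sub by (cases "i \<in> ?U") auto
  then have "\<sigma> ` S \<subseteq> S" by auto
  ultimately have "bij_betw \<sigma> S S" using \<open>finite S\<close> by (auto simp: bij_betw_def dest: endo_inj_surj)
  then have "\<sigma> permutes S" using out sub by (intro bij_imp_permutes) auto
  with \<sigma> show ?thesis by blast
qed

text \<open>\<open>submatrix\<close> reads rows and columns through \<open>pick\<close>, which thus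
  translates positions in a block into nodes.\<close>

lemma bij_betw_pick:
  assumes "finite V"
  shows "bij_betw (pick V) {0..<card V} V"
proof -
  have "inj_on (pick V) {0..<card V}"
    using pick_mono_le[of _ V] by (intro linorder_inj_onI) (auto simp: less_imp_neq)
  moreover have "pick V ` {0..<card V} \<subseteq> V" using pick_in_set_le by auto
  ultimately show ?thesis
    using assms by (intro bij_betw_imageI card_subset_eq) (simp_all add: card_image)
qed

text \<open>Edges of \<open>E ^^ k\<close> preserve the class \<open>h\<close>, and \<sigma> makes
  each class a segment of positions. Nodes of equal class reach each other in \<open>E ^^ k\<close>,
  whence irreducibility, and \<open>period_relpow\<close> gives the cyclicity.\<close>

lemma component_blocks:
  assumes "k > 0" and V: "V = {j. (v, j) \<in> E\<^sup>*}" "V \<subseteq> {0..<n}"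
    and h: "h ` V = {..<gcd k (period E v)}"
      "\<And>i j. i \<in> V \<Longrightarrow> j \<in> V \<Longrightarrow> (i, j) \<in> (E ^^ k)\<^sup>* \<longleftrightarrow> h i = h j"
    and ret: "\<And>j. j \<in> V \<Longrightarrow> (j, v) \<in> E\<^sup>*"
    and \<sigma>: "bij_betw \<sigma> V V" "\<And>i j. i \<in> V \<Longrightarrow> j \<in> V \<Longrightarrow> i \<le> j \<Longrightarrow> h (\<sigma> i) \<le> h (\<sigma> j)"
  shows "\<exists>Bs. submatrix (rel_mat n {(i, j). (\<sigma> i, \<sigma> j) \<in> E ^^ k}) V V = diag_block_mat Bs \<and>
    length Bs = gcd k (period E v) \<and>
    (\<forall>B\<in>set Bs. irreducible_mat B \<and> mat_cyclicity B = period E v div gcd k (period E v))"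
proof -
  have fin: "finite V" using V(2) by (rule finite_subset) simp
  define m where "m = card V"
  define \<rho> where "\<rho> = \<sigma> \<circ> pick V"
  have pick: "bij_betw (pick V) {0..<m} V" using bij_betw_pick[OF fin] by (simp add: m_def)
  then have \<rho>: "bij_betw \<rho> {0..<m} V" unfolding \<rho>_def using \<sigma>(1) by (rule bij_betw_trans)
  then have \<rho>_in: "\<rho> a \<in> V" if "a < m" for a using bij_betwE[OF \<rho>] that by simp
  have pick_mono: "pick V a \<le> pick V b" if "a \<le> b" "b < m" for a b
    using that pick_mono_le[of b V a] by (cases "a = b") (auto simp: m_def)
  have closed: "j \<in> V \<and> h i = h j" if "i \<in> V" "(i, j) \<in> E ^^ k" for i j
  proof
    show "j \<in> V" using that by (auto simp: V(1) dest: relpow_imp_rtrancl)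
    then show "h i = h j" using that h(2) by blast
  qed
  define N :: "real mat" where "N = mat m m (\<lambda>(a, b). if (\<rho> a, \<rho> b) \<in> E ^^ k then 1 else 0)"
  have "{i. i < n \<and> i \<in> V} = V" using V(2) by auto
  then have sub: "submatrix (rel_mat n {(i, j). (\<sigma> i, \<sigma> j) \<in> E ^^ k}) V V = N"
  proof -
    have "pick V a < n" if "a < m" for a
    proof -
      have "pick V a \<in> V" using bij_betwE[OF pick] that by simp
      then show ?thesis using V(2) by auto
    qed
    with \<open>{i. i < n \<and> i \<in> V} = V\<close> show ?thesis
      by (intro eq_matI) (auto simp: submatrix_def N_def rel_mat_def \<rho>_def m_def)
  qed
  have "\<exists>Bs. N = diag_block_mat Bs \<and> length Bs = gcd k (period E v) \<and>
    (\<forall>B\<in>set Bs. \<exists>c<gcd k (period E v). \<exists>s w. {a. a < m \<and> h (\<rho> a) = c} = {s..<s + w} \<and>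
      B = mat w w (\<lambda>(i, j). N $$ (s + i, s + j)))"
  proof (rule diag_block_mat_of_monotone_classes[where g = "\<lambda>a. h (\<rho> a)"])
    show "h (\<rho> i) \<le> h (\<rho> j)" if "i \<le> j" "j < m" for i j
      using \<sigma>(2)[OF _ _ pick_mono[OF that]] bij_betwE[OF pick] that by (simp add: \<rho>_def)
    show "h (\<rho> i) < gcd k (period E v)" if "i < m" for i using h(1) \<rho>_in[OF that] by auto
    show "N $$ (i, j) = 0" if "i < m" "j < m" "h (\<rho> i) \<noteq> h (\<rho> j)" for i j
      using closed[OF \<rho>_in[OF that(1)]] that by (auto simp: N_def)
  qed (simp add: N_def)
  then obtain Bs where Bs: "N = diag_block_mat Bs" "length Bs = gcd k (period E v)"
    and blocks: "\<And>B. B \<in> set Bs \<Longrightarrow> \<exists>c<gcd k (period E v). \<exists>s w.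
      {a. a < m \<and> h (\<rho> a) = c} = {s..<s + w} \<and> B = mat w w (\<lambda>(i, j). N $$ (s + i, s + j))"
    by blast
  have "irreducible_mat B \<and> mat_cyclicity B = period E v div gcd k (period E v)"
    if "B \<in> set Bs" for B
  proof -
    obtain c s w where c: "c < gcd k (period E v)"
      and sw: "{a. a < m \<and> h (\<rho> a) = c} = {s..<s + w}"
      and B: "B = mat w w (\<lambda>(i, j). N $$ (s + i, s + j))"
      using blocks[OF \<open>B \<in> set Bs\<close>] by blast
    have sw_iff: "a < m \<and> h (\<rho> a) = c \<longleftrightarrow> s \<le> a \<and> a < s + w" for a
      using sw by (auto simp: set_eq_iff)
    define W where "W = {j \<in> V. h j = c}"
    define \<rho>' where "\<rho>' i = \<rho> (s + i)" for i
    have \<rho>': "bij_betw \<rho>' {0..<w} W"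
    proof (rule bij_betw_imageI)
      show "inj_on \<rho>' {0..<w}"
      proof (rule inj_onI)
        fix i j assume ij: "i \<in> {0..<w}" "j \<in> {0..<w}" "\<rho>' i = \<rho>' j"
        then have "s + i < m" "s + j < m" using sw_iff[of "s + i"] sw_iff[of "s + j"] by auto
        moreover have "\<rho> (s + i) = \<rho> (s + j)" using ij by (simp add: \<rho>'_def)
        ultimately have "s + i = s + j" using bij_betw_imp_inj_on[OF \<rho>] by (auto dest: inj_onD)
        then show "i = j" by simp
      qed
      show "\<rho>' ` {0..<w} = W"
      proof (intro equalityI subsetI)
        fix j assume "j \<in> W"
        then obtain a where "a < m" "j = \<rho> a" "h j = c" using \<rho> by (auto simp: W_def bij_betw_def)
        with sw_iff[of a] show "j \<in> \<rho>' ` {0..<w}"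
          by (intro image_eqI[of _ _ "a - s"]) (auto simp: \<rho>'_def)
      next
        fix j assume "j \<in> \<rho>' ` {0..<w}"
        then obtain i where "i < w" "j = \<rho> (s + i)" by (auto simp: \<rho>'_def)
        then show "j \<in> W" using sw_iff[of "s + i"] \<rho>_in[of "s + i"] by (simp add: W_def)
      qed
    qed
    \<comment> \<open>Every class is inhabited, so the block is not of size 0, which would not be
      strongly connected.\<close>
    have "c \<in> h ` V" using c h(1) by simp
    then have "W \<noteq> {}" by (auto simp: W_def)
    then have "w > 0" using \<rho>' by (auto simp: bij_betw_def)
    have W_closed: "j \<in> W" if "i \<in> W" "(i, j) \<in> E ^^ k" for i j
      using closed[of i j] that by (auto simp: W_def)
    define R where "R = {(i, j). i \<in> {0..<w} \<and> j \<in> {0..<w} \<and> (\<rho>' i, \<rho>' j) \<in> E ^^ k}"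
    have R_rtrancl: "(i, j) \<in> R\<^sup>* \<longleftrightarrow> (\<rho>' i, \<rho>' j) \<in> (E ^^ k)\<^sup>*"
      if "i \<in> {0..<w}" "j \<in> {0..<w}" for i j
      unfolding R_def by (rule rtrancl_pullback[OF \<rho>' _ that]) (rule W_closed)
    have R_period: "period R i = period (E ^^ k) (\<rho>' i)" if "i \<in> {0..<w}" for i
      unfolding R_def by (rule period_pullback[OF \<rho>' _ that]) (rule W_closed)
    have B_carrier: "B \<in> carrier_mat w w" by (simp add: B)
    have parcs: "parcs (mat_digraph B) = R"
    proof -
      have "s + i < m" if "i < w" for i using sw_iff[of "s + i"] that by simp
      then have "B $$ (i, j) \<noteq> 0 \<longleftrightarrow> (\<rho>' i, \<rho>' j) \<in> E ^^ k" if "i < w" "j < w" for i j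
        using that by (simp add: B N_def \<rho>'_def)
      then show ?thesis unfolding mat_digraph_simps(2)[OF B_carrier] R_def by auto
    qed
    interpret D: pair_fin_digraph "mat_digraph B"
      using B_carrier by (rule pair_fin_digraph_mat_digraph)
    have \<rho>'_W: "\<rho>' i \<in> W" if "i < w" for i using bij_betwE[OF \<rho>'] that by simp
    have connected: "(i, j) \<in> R\<^sup>*" if "i < w" "j < w" for i j
      using R_rtrancl[of i j] that \<rho>'_W[of i] \<rho>'_W[of j] h(2) by (auto simp: W_def)
    have verts: "pverts (mat_digraph B) = {0..<w}" by (rule mat_digraph_simps(1)[OF B_carrier])
    have "strongly_connected (with_proj (mat_digraph B))"
      using connected \<open>w > 0\<close>
      by (auto simp: strongly_connected_def D.reachable_iff_rtrancl verts parcs)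
    moreover have "mat_cyclicity B = period E v div gcd k (period E v)"
    proof -
      have "mat_cyclicity B = period R 0"
        unfolding mat_cyclicity_def parcs[symmetric]
        using connected \<open>w > 0\<close> by (intro D.cyclicity_eq_period) (auto simp: verts parcs)
      also have "\<dots> = period (E ^^ k) (\<rho>' 0)" using R_period[of 0] \<open>w > 0\<close> by simp
      also have "\<dots> = period E (\<rho>' 0) div gcd k (period E (\<rho>' 0))" using \<open>k > 0\<close> by (rule period_relpow)
      also have "period E (\<rho>' 0) = period E v"
        using \<rho>'_W[OF \<open>w > 0\<close>] ret by (intro period_eq) (auto simp: W_def V(1))
      finally show ?thesis .
    qed
    ultimately show ?thesis using B_carrier by (simp add: irreducible_mat_def)
  qed
  with sub Bs show ?thesis by blast
qed

section \<open>Critical matrices of permuted conjugates, and the three claims\<close>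

lemma crit_mat_eq_rel_mat:
  assumes "B \<in> carrier_mat n n"
  shows "crit_mat B = rel_mat n (parcs (critical_graph B))"
  using assms by (simp add: crit_mat_def rel_mat_def)

text \<open>The vector \<open>x \<circ> \<sigma>\<close> serves the conjugate with the same \<mu>,
  and its saturation graph is the pullback along \<sigma>; thus no cycle has to be
  transported.\<close>

lemma (in subeigen) crit_mat_conjugate:
  assumes "cyclic_part S \<noteq> {}" "\<sigma> permutes {0..<n}"
  shows "crit_mat (permutation_mat n (Hilbert_Choice.inv \<sigma>) \<otimes>\<^sub>m B \<otimes>\<^sub>m permutation_mat n \<sigma>)
    = rel_mat n {(i, j). (\<sigma> i, \<sigma> j) \<in> cyclic_part S}"
proof -
  define M where "M = permutation_mat n (Hilbert_Choice.inv \<sigma>) \<otimes>\<^sub>m B \<otimes>\<^sub>m permutation_mat n \<sigma>"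
  have perm: "permutation_mat n \<tau> \<in> carrier_mat n n" for \<tau> by (simp add: permutation_mat_def)
  have M_carrier: "M \<in> carrier_mat n n"
    unfolding M_def using carrier perm by (intro max_mult_mat_carrier)
  have QB: "permutation_mat n (Hilbert_Choice.inv \<sigma>) \<otimes>\<^sub>m B \<in> carrier_mat n n"
    using carrier perm by (intro max_mult_mat_carrier)
  have lt: "\<sigma> i < n" if "i < n" for i using permutes_in_image[OF assms(2)] that by simp
  have M: "M $$ (i, j) = B $$ (\<sigma> i, \<sigma> j)" if "i < n" "j < n" for i j
    unfolding M_def
    using max_mult_permutation_mat(1)[OF QB nonneg_max_mult_mat assms(2) that]
      max_mult_permutation_mat(2)[OF carrier nonneg assms(2) that(1) lt[OF that(2)]] by simp
  interpret M: subeigen M n "x \<circ> \<sigma>" \<mu>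
  proof
    show "nonneg_mat M" by (simp add: M_def nonneg_max_mult_mat)
    show "subeigenvector M n (x \<circ> \<sigma>) \<mu>"
      using x_pos entry_le lt M by (simp add: subeigenvector_def)
  qed (use M_carrier pos in auto)
  have bij: "bij_betw \<sigma> {0..<n} {0..<n}" using assms(2) by (rule permutes_imp_bij)
  have sat: "M.S = {(i, j). i \<in> {0..<n} \<and> j \<in> {0..<n} \<and> (\<sigma> i, \<sigma> j) \<in> S}"
    using M lt by (auto simp: saturation_graph_def)
  have closed: "j \<in> {0..<n}" if "(i, j) \<in> S" for i j
    using that by (simp add: saturation_graph_def)
  have cyc: "cyclic_part M.S = {(i, j). i \<in> {0..<n} \<and> j \<in> {0..<n} \<and> (\<sigma> i, \<sigma> j) \<in> cyclic_part S}"
  proof -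
    have "(j, i) \<in> M.S\<^sup>* \<longleftrightarrow> (\<sigma> j, \<sigma> i) \<in> S\<^sup>*" if "i \<in> {0..<n}" "j \<in> {0..<n}" for i j
      unfolding sat by (rule rtrancl_pullback[OF bij _ that(2,1)]) (rule closed)
    then show ?thesis unfolding cyclic_part_def by (auto simp: sat)
  qed
  obtain a b where ab: "(a, b) \<in> cyclic_part S" using assms(1) by auto
  then have "a \<in> \<sigma> ` {0..<n}" "b \<in> \<sigma> ` {0..<n}"
    using cyclic_part_subset[of S] bij by (auto simp: saturation_graph_def bij_betw_def)
  then obtain i j where "i \<in> {0..<n}" "j \<in> {0..<n}" "a = \<sigma> i" "b = \<sigma> j" by blast
  with ab have "(i, j) \<in> cyclic_part M.S" unfolding cyc by simp
  then have "cyclic_part M.S \<noteq> {}" by blast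
  then have "parcs (critical_graph M) = cyclic_part M.S" by (rule M.parcs_critical_graph)
  then have "crit_mat M = rel_mat n (cyclic_part M.S)" using crit_mat_eq_rel_mat[OF M_carrier] by simp
  also have "\<dots> = rel_mat n {(i, j). (\<sigma> i, \<sigma> j) \<in> cyclic_part S}"
    unfolding cyc rel_mat_def by (intro cong_mat) auto
  finally show ?thesis unfolding M_def .
qed

theorem proposition3p3:
  fixes A :: "real mat" and n k :: nat
  assumes "A \<in> carrier_mat n n"
    and "nonneg_mat A"
    and "max_cycle_mean A \<noteq> 0"
    and "k \<ge> 1"
  shows "max_cycle_mean (max_pow_mat A k) = max_cycle_mean A ^ k \<and>
         max_pow_mat (crit_mat A) k = crit_mat (max_pow_mat A k) \<and>
         (\<exists>\<sigma> P Q. \<sigma> permutes {0..<n} \<and> P = permutation_mat n \<sigma> \<and> max_inverse_mat P Q \<and>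
           (\<forall>C \<in> critical_components A.
              \<sigma> ` verts C = verts C \<and>
              (\<exists>Bs. submatrix (crit_mat (Q \<otimes>\<^sub>m max_pow_mat A k \<otimes>\<^sub>m P)) (verts C) (verts C)
                      = diag_block_mat Bs \<and>
                    length Bs = gcd k (cyclicity C) \<and>
                    (\<forall>B \<in> set Bs. irreducible_mat B \<and>
                       mat_cyclicity B = cyclicity C div gcd k (cyclicity C)))))"
proof -
  let ?l = "max_cycle_mean A"
  obtain p where p: "mat_cycle A p" "cycle_mean A p = ?l" "?l > 0"
    "\<And>p. mat_cycle A p \<Longrightarrow> path_weight A p \<le> ?l ^ length p"
    using max_cycle_mean_pos[OF assms(2,1,3)] by blast
  obtain x where "subeigenvector A n x ?l"
    using subeigenvector_exists[OF assms(1,2) p(3,4)] by blast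
  then interpret A: subeigen A n x ?l
    using assms p by unfold_locales
  have "k > 0" using assms(4) by simp
  define E where "E = cyclic_part A.S"
  have "set p \<subseteq> cyclic_part A.S"
    using A.cycle_subset_cyclic_part[OF p(1)] A.cycle_mean_le(2)[OF p(1)] p(2) by blast
  moreover have "p \<noteq> []" using p(1) by (auto simp: A.D.cycle_def)
  ultimately have cyc_ne: "cyclic_part A.S \<noteq> {}" by auto
  have E_sub: "E \<subseteq> {0..<n} \<times> {0..<n}"
    using cyclic_part_subset[of A.S] unfolding E_def by (auto simp: saturation_graph_def)
  have graph: "parcs (critical_graph A) = E" "pverts (critical_graph A) = Field E"
    using A.parcs_critical_graph[OF cyc_ne] A.pverts_critical_graph[OF cyc_ne] by (simp_all add: E_def)
  have successor: "\<exists>j. (i, j) \<in> E" if "i \<in> Field E" for i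
    using that unfolding E_def by (rule cyclic_part_successor)
  have E_sym: "(j, i) \<in> E\<^sup>*" if "(i, j) \<in> E\<^sup>*" for i j
    using that unfolding E_def by (rule cyclic_part_rtrancl_sym)

  interpret K: subeigen "max_pow_mat A k" n x "?l ^ k" by (rule A.subeigen_max_pow_mat)
  have K_S: "K.S = A.S ^^ k"
  proof -
    \<comment> \<open>Here \<open>k > 0\<close> enters: the walk has a first edge, so it starts at
      an index below \<open>n\<close>.\<close>
    have dom: "i < n" if "(i, j) \<in> A.S ^^ k" for i j
    proof -
      obtain l where "k = Suc l" using \<open>k > 0\<close> gr0_implies_Suc by blast
      with that have "(i, j) \<in> A.S ^^ Suc l" by (simp only:)
      from relpow_Suc_D2[OF this] obtain y where "(i, y) \<in> A.S" by blast
      then show ?thesis by (simp add: saturation_graph_def)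
    qed
    have "(i, j) \<in> K.S \<longleftrightarrow> (i, j) \<in> A.S ^^ k" for i j
    proof (cases "i < n")
      case True
      then show ?thesis by (rule A.saturation_graph_max_pow_mat)
    next
      case False
      then have "(i, j) \<notin> K.S" by (simp add: saturation_graph_def[of "max_pow_mat A k"])
      with False dom show ?thesis by blast
    qed
    then show ?thesis by auto
  qed
  have K_cyc: "cyclic_part K.S = E ^^ k"
    unfolding K_S E_def using \<open>k > 0\<close> by (rule cyclic_part_relpow)
  obtain i where "i \<in> Field E" using cyc_ne by (auto simp: E_def Field_def)
  \<comment> \<open>The critical graph has no dead ends, so critical walks of length
    \<open>k\<close> exist; this makes \<lambda>^k attained in the power.\<close>
  then have "\<exists>j. (i, j) \<in> E ^^ k" using successor by (rule_tac relpow_successor)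
  then have K_ne: "cyclic_part K.S \<noteq> {}" unfolding K_cyc by blast

  have part1: "max_cycle_mean (max_pow_mat A k) = ?l ^ k" using K_ne by (rule K.max_cycle_mean_eq)
  have part2: "max_pow_mat (crit_mat A) k = crit_mat (max_pow_mat A k)"
    unfolding crit_mat_eq_rel_mat[OF assms(1)] crit_mat_eq_rel_mat[OF K.carrier] graph
      K.parcs_critical_graph[OF K_ne] K_cyc using E_sub by (rule max_pow_mat_rel_mat)

  interpret G: pair_wf_digraph "critical_graph A"
    by unfold_locales (auto simp: graph Field_def)
  let ?r = "\<lambda>C. gcd k (cyclicity C)"
  \<comment> \<open>Bundling the properties lets base nodes and class functions be chosen for all
    components simultaneously.\<close>
  define cyclic_partition where "cyclic_partition C v h \<longleftrightarrow>
    v \<in> Field E \<and> verts C = {j. (v, j) \<in> E\<^sup>*} \<and> cyclicity C = period E v \<and>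
    h ` verts C = {..<?r C} \<and>
    (\<forall>i\<in>verts C. \<forall>j\<in>verts C. (i, j) \<in> (E ^^ k)\<^sup>* \<longleftrightarrow> h i = h j)"
    for C :: "(nat, nat \<times> nat) pre_digraph" and v and h :: "nat \<Rightarrow> nat"
  have "\<exists>v h. cyclic_partition C v h" if C: "C \<in> critical_components A" for C
  proof -
    obtain v where v: "v \<in> Field E" "verts C = {j. (v, j) \<in> E\<^sup>*}" "cyclicity C = period E v"
      using G.sccs_if_rtrancl_sym[of C] E_sym C unfolding critical_components_def graph by blast
    have succ: "\<exists>j. (i, j) \<in> E" if "i \<in> verts C" for i
    proof -
      have "i \<in> Field E" using that v(1,2) by (auto elim: rtranclE simp: Field_def)
      then show ?thesis by (rule successor)
    qed
    have ret: "(i, v) \<in> E\<^sup>*" if "i \<in> verts C" for i using that v(2) E_sym by auto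
    have "\<exists>h. h ` verts C = {..<gcd k (period E v)} \<and>
      (\<forall>i\<in>verts C. \<forall>j\<in>verts C. (i, j) \<in> (E ^^ k)\<^sup>* \<longleftrightarrow> h i = h j)"
      by (rule cyclic_classes[OF \<open>k > 0\<close> v(2)]) (fact ret succ)+
    then show ?thesis using v(1) unfolding cyclic_partition_def v(2,3) by blast
  qed
  then obtain v h where partition:
    "\<And>C. C \<in> critical_components A \<Longrightarrow> cyclic_partition C (v C) (h C)"
    by metis
  have v: "v C \<in> Field E" "verts C = {j. (v C, j) \<in> E\<^sup>*}" "cyclicity C = period E (v C)"
    and h: "h C ` verts C = {..<?r C}" "\<And>i j. i \<in> verts C \<Longrightarrow> j \<in> verts C \<Longrightarrow>
      (i, j) \<in> (E ^^ k)\<^sup>* \<longleftrightarrow> h C i = h C j"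
    if C: "C \<in> critical_components A" for C
  proof -
    note part = partition[OF C, unfolded cyclic_partition_def]
    show "v C \<in> Field E" using part by (rule conjunct1)
    show "verts C = {j. (v C, j) \<in> E\<^sup>*}" using part by (elim conjE)
    show "cyclicity C = period E (v C)" using part by (elim conjE)
    show "h C ` verts C = {..<?r C}" using part by (elim conjE)
    show "(i, j) \<in> (E ^^ k)\<^sup>* \<longleftrightarrow> h C i = h C j" if "i \<in> verts C" "j \<in> verts C" for i j
      using part that by (elim conjE) (drule (1) bspec)+
  qed
  have verts_sub: "verts C \<subseteq> {0..<n}" if "C \<in> critical_components A" for C
  proof
    fix j assume "j \<in> verts C"
    then have "j \<in> Field E" using v(1,2)[OF that] by (auto elim: rtranclE simp: Field_def)
    then show "j \<in> {0..<n}" using E_sub by (auto simp: Field_def)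
  qed
  have verts_disj: "C = D" if "C \<in> critical_components A" "D \<in> critical_components A"
    "verts C \<inter> verts D \<noteq> {}" for C D
    using G.scc_disj[of C D] that by (auto simp: critical_components_def)
  define sorting where "sorting C \<tau> \<longleftrightarrow> bij_betw \<tau> (verts C) (verts C) \<and>
    (\<forall>i\<in>verts C. \<forall>j\<in>verts C. i \<le> j \<longrightarrow> h C (\<tau> i) \<le> h C (\<tau> j))" for C \<tau>
  have "\<exists>\<tau>. sorting C \<tau>" if "C \<in> critical_components A" for C
    unfolding sorting_def
    using finite_subset[OF verts_sub[OF that]] by (intro bij_betw_monotone_key) auto
  then obtain \<tau> where "\<And>C. C \<in> critical_components A \<Longrightarrow> sorting C (\<tau> C)" by metis
  then have \<tau>: "bij_betw (\<tau> C) (verts C) (verts C)"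
    "\<And>i j. i \<in> verts C \<Longrightarrow> j \<in> verts C \<Longrightarrow> i \<le> j \<Longrightarrow> h C (\<tau> C i) \<le> h C (\<tau> C j)"
    if "C \<in> critical_components A" for C
    using that unfolding sorting_def by blast+
  have "\<exists>\<sigma>. \<sigma> permutes {0..<n} \<and>
    (\<forall>C\<in>critical_components A. \<forall>i\<in>verts C. \<sigma> i = \<tau> C i)"
    by (rule permutes_combine) (fact finite_atLeastLessThan verts_disj verts_sub \<tau>(1))+
  then obtain \<sigma> where \<sigma>: "\<sigma> permutes {0..<n}"
    "\<And>C i. C \<in> critical_components A \<Longrightarrow> i \<in> verts C \<Longrightarrow> \<sigma> i = \<tau> C i"
    by auto
  let ?P = "permutation_mat n \<sigma>" and ?Q = "permutation_mat n (Hilbert_Choice.inv \<sigma>)"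
  have crit: "crit_mat (?Q \<otimes>\<^sub>m max_pow_mat A k \<otimes>\<^sub>m ?P) = rel_mat n {(i, j). (\<sigma> i, \<sigma> j) \<in> E ^^ k}"
    using K.crit_mat_conjugate[OF K_ne \<sigma>(1)] unfolding K_cyc .
  have blocks: "\<sigma> ` verts C = verts C \<and>
    (\<exists>Bs. submatrix (crit_mat (?Q \<otimes>\<^sub>m max_pow_mat A k \<otimes>\<^sub>m ?P)) (verts C) (verts C)
        = diag_block_mat Bs \<and>
      length Bs = ?r C \<and>
      (\<forall>B \<in> set Bs. irreducible_mat B \<and> mat_cyclicity B = cyclicity C div ?r C))"
    if C: "C \<in> critical_components A" for C
  proof
    \<comment> \<open>Since \<sigma> maps the component onto itself, the block of the conjugate at
      these indices is a rearrangement of the block of the power at the same indices.\<close>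
    have bij: "bij_betw \<sigma> (verts C) (verts C)"
      using \<tau>(1)[OF C] bij_betw_cong[of "verts C" \<sigma> "\<tau> C"] \<sigma>(2)[OF C] by blast
    then show "\<sigma> ` verts C = verts C" by (simp add: bij_betw_def)
    have mono: "h C (\<sigma> i) \<le> h C (\<sigma> j)" if "i \<in> verts C" "j \<in> verts C" "i \<le> j" for i j
      using \<tau>(2)[OF C that] \<sigma>(2)[OF C] that by simp
    have ret: "(j, v C) \<in> E\<^sup>*" if "j \<in> verts C" for j
      using that v(2)[OF C] E_sym by auto
    show "\<exists>Bs. submatrix (crit_mat (?Q \<otimes>\<^sub>m max_pow_mat A k \<otimes>\<^sub>m ?P)) (verts C) (verts C)
        = diag_block_mat Bs \<and>
      length Bs = ?r C \<and>
      (\<forall>B \<in> set Bs. irreducible_mat B \<and> mat_cyclicity B = cyclicity C div ?r C)"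
      unfolding crit v(3)[OF C]
    proof (rule component_blocks[OF \<open>k > 0\<close> v(2)[OF C] verts_sub[OF C]])
      show "h C ` verts C = {..<gcd k (period E (v C))}" using h(1)[OF C] v(3)[OF C] by simp
    qed (fact h(2)[OF C] ret bij mono)+
  qed
  show ?thesis
    by (intro conjI part1 part2 exI[of _ \<sigma>] exI[of _ ?P] exI[of _ ?Q] \<sigma>(1) refl
        max_inverse_permutation_mat[OF \<sigma>(1)]) (use blocks in \<open>rule ballI\<close>)
qed

end
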